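(* Let $1<b<2$, let $W_1:\mathbb{R}\to\mathbb{R}$ be smooth, and let $$W(x)=-\frac{|x|^b}{b}+W_1(x),\qquad x\in\mathbb{R}.$$ Let $R>0$ and let $\rho\in\mathcal{P}(\mathbb{R})$ be a $d_\infty$-local minimizer of the interaction energy $E$ associated to $W$ which is supported inside $(-R,R)$ and satisfies $W*\rho\in C^1([-R,R])$. Then there exists $c_s>0$, depending only on $b$, $R$ and $\|W_1\|_{C^4([-2R,2R])}$, such that the Lebesgue measure of the support satisfies $|\operatorname{supp}\rho|\ge c_s$. In particular, $\dim(\operatorname{supp}\rho)=1$.
   Context: $\mathcal{P}(\mathbb{R})$: Borel probability measures on $\mathbb{R}$. $E[\rho]=\frac12\int\int W(x-y)\,d\rho(y)\,d\rho(x)$. $W$ is assumed symmetric ($W(x)=W(-x)$, so $W_1$ is even) and bounded below. $\dim$ denotes (Hausdorff) dimension. $d_\infty(\mu,\nu)=\inf_{\pi\in\Pi(\mu,\nu)}\sup_{(x,y)\in\operatorname{supp}\pi}|x-y|$ for compactly supported $\mu,\nu$ ($\Pi(\mu,\nu)$: transport plans). $\rho$ is a $d_\infty$-local minimizer of $E$ if there is $\epsilon>0$ with $E[\rho]\le E[\nu]$ for all compactly supported $\nu\in\mathcal{P}(\mathbb{R})$ with $d_\infty(\rho,\nu)<\epsilon$. *)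

theory Defs
  imports "HOL-Probability.Probability"
begin

definition smooth :: "(real \<Rightarrow> real) \<Rightarrow> bool" where
  "smooth f \<longleftrightarrow> (\<forall>n x. (deriv ^^ n) f differentiable (at x))"

text \<open>The sum of the suprema of the derivatives up to order \<open>k\<close>; this is meant for smooth \<open>f\<close>
  and compact nonempty \<open>S\<close>, where all the suprema are finite.\<close>

definition C_norm :: "nat \<Rightarrow> real set \<Rightarrow> (real \<Rightarrow> real) \<Rightarrow> real" where
  "C_norm k S f = (\<Sum>i\<le>k. SUP x\<in>S. \<bar>(deriv ^^ i) f x\<bar>)"

text \<open>The derivatives at the endpoints of an interval \<open>S\<close> are one-sided.\<close>

definition C1_on :: "real set \<Rightarrow> (real \<Rightarrow> real) \<Rightarrow> bool" where
  "C1_on S f \<longleftrightarrow>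
     (\<exists>g. (\<forall>x\<in>S. (f has_real_derivative g x) (at x within S)) \<and> continuous_on S g)"

definition supp :: "'a::topological_space measure \<Rightarrow> 'a set" where
  "supp \<mu> = {x. \<forall>U. open U \<longrightarrow> x \<in> U \<longrightarrow> emeasure \<mu> U > 0}"

definition transport_plans :: "real measure \<Rightarrow> real measure \<Rightarrow> (real \<times> real) measure set" where
  "transport_plans \<mu> \<nu> =
     {\<pi>. sets \<pi> = sets borel \<and> prob_space \<pi> \<and> distr \<pi> borel fst = \<mu> \<and> distr \<pi> borel snd = \<nu>}"

definition d_inf :: "real measure \<Rightarrow> real measure \<Rightarrow> ennreal" where
  "d_inf \<mu> \<nu> = (INF \<pi>\<in>transport_plans \<mu> \<nu>. SUP (x, y)\<in>supp \<pi>. ennreal \<bar>x - y\<bar>)"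

text \<open>A Bochner integral, hence 0 if the integrand is not integrable. Below, the energy is only
  used for continuous \<open>W\<close> and compactly supported probability measures, where it is finite.\<close>

definition interaction_energy :: "(real \<Rightarrow> real) \<Rightarrow> real measure \<Rightarrow> real" where
  "interaction_energy W \<rho> = (1 / 2) * (LINT x|\<rho>. LINT y|\<rho>. W (x - y))"

definition conv :: "(real \<Rightarrow> real) \<Rightarrow> real measure \<Rightarrow> real \<Rightarrow> real" where
  "conv W \<rho> x = (LINT y|\<rho>. W (x - y))"

definition d_inf_local_minimizer :: "(real \<Rightarrow> real) \<Rightarrow> real measure \<Rightarrow> bool" where
  "d_inf_local_minimizer W \<rho> \<longleftrightarrow>
     (\<exists>\<epsilon>>0. \<forall>\<nu>. sets \<nu> = sets borel \<and> prob_space \<nu> \<and> compact (supp \<nu>) \<and> d_inf \<rho> \<nu> < ennreal \<epsilon>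
        \<longrightarrow> interaction_energy W \<rho> \<le> interaction_energy W \<nu>)"

text \<open>The summand contributed by a covering set to the \<open>s\<close>-dimensional Hausdorff measure, with
  the convention that a nonempty set counts 1 if \<open>s = 0\<close> (whereas \<open>0 powr 0 = 0\<close>).\<close>

definition hausdorff_gauge :: "real \<Rightarrow> 'a::metric_space set \<Rightarrow> ennreal" where
  "hausdorff_gauge s U =
     (if U = {} then 0 else if s = 0 then 1 else ennreal (diameter U powr s))"

text \<open>Boundedness of the covering sets is required because \<open>diameter\<close> is meaningless on
  unbounded sets.\<close>

definition hausdorff_premeasure :: "real \<Rightarrow> real \<Rightarrow> 'a::metric_space set \<Rightarrow> ennreal" where
  "hausdorff_premeasure s \<delta> A =
     (INF U\<in>{U :: nat \<Rightarrow> 'a set. A \<subseteq> (\<Union>i. U i) \<and> (\<forall>i. bounded (U i) \<and> diameter (U i) \<le> \<delta>)}.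
        \<Sum>i. hausdorff_gauge s (U i))"

definition hausdorff_measure :: "real \<Rightarrow> 'a::metric_space set \<Rightarrow> ennreal" where
  "hausdorff_measure s A = (SUP \<delta>\<in>{0<..}. hausdorff_premeasure s \<delta> A)"

definition hausdorff_dim :: "'a::metric_space set \<Rightarrow> ennreal" where
  "hausdorff_dim A = (INF s\<in>{s. 0 \<le> s \<and> hausdorff_measure s A = 0}. ennreal s)"

end

theory Submission
  imports Defs
begin

text \<open>
  Write \<open>\<psi> = W * \<rho>\<close>. The kernel has a concave cusp at the origin, \<open>W'' \<rightarrow> -\<infinity>\<close>, and this
  repulsion is so strong that it spreads the mass over a full interval.

  Moving a small fraction of the mass near a point \<open>x\<close> of the support to a nearby point \<open>z\<close>
  changes the energy to first order by a multiple of \<open>\<psi> z - \<psi> x\<close>, so every point of the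
  support is a local minimum of \<open>\<psi>\<close> (\<open>d_inf_local_minimizer_imp_local_min\<close>). Differentiating
  under the integral (\<open>conv_has_real_derivative\<close>), \<open>g = \<psi>' = W' * \<rho>\<close> vanishes on the support, takes
  values \<open>\<ge> 0\<close> arbitrarily close to the right of each of its points and values \<open>\<le> 0\<close> arbitrarily
  close to the left.

  Let \<open>J\<close> be an interval of small length \<open>l\<close>. Off the origin, \<open>W''''\<close> equals \<open>-\<kappa> \<bar>t\<bar>\<^sup>b\<^sup>-\<^sup>4\<close> up to a bounded
  error, where \<open>\<kappa> = (b - 1) (2 - b) (3 - b) > 0\<close>. By the pigeonhole principle \<open>J\<close> can be chosen with mass
  at least \<open>l / (2 R)\<close>, and since \<open>l\<^sup>b\<^sup>-\<^sup>4 l \<rightarrow> \<infinity>\<close> as \<open>l \<rightarrow> 0\<close>, the points of \<open>J\<close> then make \<open>\<psi>''''\<close>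
  negative on \<open>J\<close> outside the support. Suppose that the support had a gap \<open>(a, c)\<close> in \<open>J\<close>, with
  \<open>a\<close> and \<open>c\<close> in the support. Choose \<open>a < x\<^sub>1 < x\<^sub>2 < c\<close> with
  \<open>g x\<^sub>1 \<ge> 0 \<ge> g x\<^sub>2\<close>. As \<open>g\<close> vanishes at \<open>a\<close> and \<open>c\<close>, its third divided difference at
  \<open>a, x\<^sub>1, x\<^sub>2, c\<close> is nonnegative, whereas negativity of \<open>g'''\<close> makes it negative
  (\<open>conv_third_difference_neg\<close>). Hence the support meets \<open>J\<close> in an interval \<open>[p, q]\<close>, which carries
  the mass of \<open>J\<close>.

  This interval cannot be short: for \<open>x\<close> slightly to the right of \<open>q\<close>, the mass in \<open>[p, q]\<close>
  contributes to \<open>g x - g p\<close> at most a negative multiple of \<open>(x - p)\<^sup>b\<^sup>-\<^sup>1\<close>, which for short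
  intervals beats the error \<open>O(x - p)\<close> coming from the smooth part, and \<open>g x < 0\<close> would contradict
  the local minimality at \<open>q\<close> (\<open>support_contains_interval\<close>).

  All constants depend only on \<open>b\<close>, \<open>R\<close> and the bound on \<open>W\<^sub>1\<close>. The dimension is \<open>1\<close> because
  Lebesgue measure is bounded by a multiple of the \<open>s\<close>-dimensional Hausdorff measure for \<open>s \<le> 1\<close>.
\<close>

section \<open>Supports\<close>

lemma closed_supp: "closed (supp \<mu>)"
proof -
  have "- supp \<mu> = \<Union>{U. open U \<and> emeasure \<mu> U = 0}"
    unfolding supp_def by (auto simp: zero_less_iff_neq_zero)
  then have "open (- supp \<mu>)" by (metis (no_types, lifting) mem_Collect_eq open_Union)
  then show ?thesis by (simp add: closed_def)
qed

text \<open>The complement of the support is covered by countably many null sets, namely the null sets of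
  a countable base.\<close>

lemma AE_in_supp:
  fixes \<mu> :: "'a::second_countable_topology measure"
  assumes [measurable_cong]: "sets \<mu> = sets borel"
  shows "AE x in \<mu>. x \<in> supp \<mu>"
proof -
  obtain \<B> :: "'a set set" where \<B>: "countable \<B>" "topological_basis \<B>"
    using ex_countable_basis by blast
  let ?N = "\<Union>{U \<in> \<B>. emeasure \<mu> U = 0}"
  have "?N \<in> null_sets \<mu>"
    using \<B> by (intro null_sets_UN'[of _ "\<lambda>U. U", simplified])
      (auto simp: null_sets_def assms dest: topological_basis_open intro: countable_subset[rotated])
  moreover have "{x \<in> space \<mu>. x \<notin> supp \<mu>} \<subseteq> ?N"
  proof
    fix x assume "x \<in> {x \<in> space \<mu>. x \<notin> supp \<mu>}"
    then obtain U where U: "open U" "x \<in> U" "emeasure \<mu> U = 0"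
      by (auto simp: supp_def zero_less_iff_neq_zero)
    obtain V where V: "V \<in> \<B>" "x \<in> V" "V \<subseteq> U"
      using topological_basisE[OF \<B>(2) U(1,2)] by metis
    have "emeasure \<mu> V \<le> emeasure \<mu> U"
      using V(3) U(1) by (intro emeasure_mono) (simp_all add: assms)
    with U(3) V show "x \<in> ?N" by auto
  qed
  ultimately show ?thesis by (rule AE_I')
qed

lemma supp_subset_closed:
  assumes "sets \<mu> = sets borel" and "closed F" and "AE x in \<mu>. x \<in> F"
  shows "supp \<mu> \<subseteq> F"
proof
  fix x assume x: "x \<in> supp \<mu>"
  show "x \<in> F"
  proof (rule ccontr)
    assume "x \<notin> F"
    then have "emeasure \<mu> (- F) > 0" using x assms(2) by (auto simp: supp_def)
    moreover have "emeasure \<mu> (- F) = 0"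
      using assms(3) by (subst AE_iff_measurable[symmetric, where P = "\<lambda>x. x \<in> F"])
        (use assms(1,2) sets_eq_imp_space_eq[OF assms(1)] in \<open>auto simp: closed_def borel_open\<close>)
    ultimately show False by simp
  qed
qed

section \<open>Moving a fraction of the mass\<close>

lemma measurable_fst_snd_borel[measurable]:
  "fst \<in> (borel :: (real \<times> real) measure) \<rightarrow>\<^sub>M borel"
  "snd \<in> (borel :: (real \<times> real) measure) \<rightarrow>\<^sub>M borel"
  by (auto intro!: borel_measurable_continuous_onI continuous_intros)

text \<open>The fraction \<open>t\<close> of the mass in \<open>B\<close> is transported to \<open>z\<close>, and the rest stays in place. The coin
  toss makes it possible to split an atom.\<close>

definition partial_shift :: "real measure \<Rightarrow> real set \<Rightarrow> real \<Rightarrow> real \<Rightarrow> (real \<times> real) measure" where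
  "partial_shift \<rho> B z t = distr (\<rho> \<Otimes>\<^sub>M measure_pmf (bernoulli_pmf t)) borel
     (\<lambda>(x, u). (x, if u \<and> x \<in> B then z else x))"

context
  fixes \<rho> :: "real measure" and B :: "real set" and z t :: real
  assumes prob: "prob_space \<rho>" and sets_rho[measurable_cong]: "sets \<rho> = sets borel"
    and B[measurable]: "B \<in> sets borel" and t: "0 \<le> t" "t \<le> 1"
begin

interpretation prob_space \<rho> by (rule prob)
interpretation PP: pair_prob_space \<rho> "measure_pmf (bernoulli_pmf t)" ..

lemma measurable_shift_map[measurable]:
  "(\<lambda>(x, u). (x, if u \<and> x \<in> B then z else x)) \<in>
     \<rho> \<Otimes>\<^sub>M measure_pmf (bernoulli_pmf t) \<rightarrow>\<^sub>M (borel :: (real \<times> real) measure)"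
  unfolding borel_prod[symmetric] by measurable

lemma AE_partial_shift:
  assumes [measurable]: "Measurable.pred borel P"
    and "AE x in \<rho>. P (x, x) \<and> (x \<in> B \<longrightarrow> P (x, z))"
  shows "AE p in partial_shift \<rho> B z t. P p"
  unfolding partial_shift_def
proof (subst AE_distr_iff)
  show "AE p in \<rho> \<Otimes>\<^sub>M measure_pmf (bernoulli_pmf t).
      P (case p of (x, u) \<Rightarrow> (x, if u \<and> x \<in> B then z else x))"
  proof (rule PP.AE_pair_measure)
    show "AE x in \<rho>. AE u in measure_pmf (bernoulli_pmf t).
        P (case (x, u) of (x, u) \<Rightarrow> (x, if u \<and> x \<in> B then z else x))"
      using assms(2) by eventually_elim (simp add: AE_I2)
  qed measurable
qed measurable

text \<open>The second marginal is the competitor for the energy; integration against it is affine in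
  \<open>t\<close>.\<close>

lemma integral_partial_shift_snd:
  fixes h :: "real \<Rightarrow> real"
  assumes [measurable]: "h \<in> borel_measurable borel" and bd: "\<And>x. \<bar>h x\<bar> \<le> K"
  shows "(LINT x|distr (partial_shift \<rho> B z t) borel snd. h x) =
    (LINT x|\<rho>. h x) + t * (LINT x|\<rho>. indicator B x * (h z - h x))"
proof -
  have 1: "integrable \<rho> h" by (rule integrable_const_bound[of _ K]) (use bd in auto)
  have bd2: "\<bar>h z - h x\<bar> \<le> 2 * K" for x using bd[of x] bd[of z] by linarith
  have K: "0 \<le> K" using bd[of 0] by linarith
  have 2: "integrable \<rho> (\<lambda>x. indicator B x * (h z - h x))"
    by (rule integrable_const_bound[of _ "2 * K"]) (use bd2 K in \<open>auto simp: indicator_def\<close>)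
  have "(LINT x|distr (partial_shift \<rho> B z t) borel snd. h x) =
      (LINT p|(\<rho> \<Otimes>\<^sub>M measure_pmf (bernoulli_pmf t)). h (if snd p \<and> fst p \<in> B then z else fst p))"
    (is "_ = (LINT p|_. ?H p)")
    unfolding partial_shift_def
    by (subst integral_distr, measurable, subst integral_distr, measurable) (simp add: case_prod_beta')
  also have "\<dots> = (LINT x|\<rho>. LINT u|measure_pmf (bernoulli_pmf t). h (if u \<and> x \<in> B then z else x))"
  proof -
    have "integrable (\<rho> \<Otimes>\<^sub>M measure_pmf (bernoulli_pmf t)) ?H"
      by (rule PP.P.integrable_const_bound[of _ K]) (use bd in auto)
    from PP.integral_fst'[OF this, symmetric] show ?thesis
      unfolding fst_conv snd_conv .
  qed
  also have "\<dots> = (LINT x|\<rho>. h x + t * (indicator B x * (h z - h x)))"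
    using t by (intro Bochner_Integration.integral_cong)
      (auto simp: indicator_def integral_bernoulli_pmf algebra_simps)
  also have "\<dots> = (LINT x|\<rho>. h x) + t * (LINT x|\<rho>. indicator B x * (h z - h x))"
    using 1 2 by simp
  finally show ?thesis .
qed

lemma transport_plan_partial_shift:
  "partial_shift \<rho> B z t \<in> transport_plans \<rho> (distr (partial_shift \<rho> B z t) borel snd)"
proof -
  have "distr (partial_shift \<rho> B z t) borel fst =
      distr (\<rho> \<Otimes>\<^sub>M measure_pmf (bernoulli_pmf t)) \<rho> fst"
    unfolding partial_shift_def
    by (subst distr_distr) (auto simp: measurable_shift_map sets_rho comp_def case_prod_beta'
        intro!: distr_cong)
  also have "\<dots> = \<rho>"
    by (rule prob_space.distr_pair_fst[OF measure_pmf.prob_space_axioms])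
  moreover have "prob_space (partial_shift \<rho> B z t)"
    unfolding partial_shift_def by (rule PP.prob_space_distr) measurable
  ultimately show ?thesis
    by (simp add: transport_plans_def partial_shift_def)
qed

text \<open>The energy is quadratic in the measure, so it is a quadratic polynomial in \<open>t\<close>. By the
  symmetry of the kernel the two mixed terms agree, which turns the linear coefficient into the
  variation of the potential \<open>conv k \<rho>\<close>.\<close>

lemma interaction_energy_partial_shift:
  fixes k :: "real \<Rightarrow> real"
  assumes k[measurable]: "k \<in> borel_measurable borel" and bd: "\<And>x. \<bar>k x\<bar> \<le> K"
    and sym: "\<And>x. k (- x) = k x"
  defines "D \<equiv> \<lambda>h :: real \<Rightarrow> real. (LINT x|\<rho>. indicator B x * (h z - h x))"
  shows "interaction_energy k (distr (partial_shift \<rho> B z t) borel snd) =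
    interaction_energy k \<rho> + t * D (conv k \<rho>) + t\<^sup>2 * (D (\<lambda>x. D (\<lambda>y. k (x - y))) / 2)"
proof -
  let ?\<nu> = "distr (partial_shift \<rho> B z t) borel snd"
  \<comment> \<open>\<open>S\<close> is the derivative of the potential with respect to \<open>t\<close>.\<close>
  define S where "S = (\<lambda>x. D (\<lambda>y. k (x - y)))"
  have K: "0 \<le> K" using bd[of 0] by linarith
  have int_bd: "integrable \<rho> f \<and> \<bar>LINT y|\<rho>. f y\<bar> \<le> C"
    if "f \<in> borel_measurable borel" "\<And>x. \<bar>f x\<bar> \<le> C" for f :: "real \<Rightarrow> real" and C
  proof
    show f: "integrable \<rho> f" by (rule integrable_const_bound[of _ C]) (use that in auto)
    have "\<bar>LINT y|\<rho>. f y\<bar> \<le> (LINT y|\<rho>. \<bar>f y\<bar>)" by (rule integral_abs_bound)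
    also have "\<dots> \<le> (LINT y|\<rho>. C)" using f that(2) by (intro integral_mono) auto
    finally show "\<bar>LINT y|\<rho>. f y\<bar> \<le> C" by (simp add: prob_space)
  qed
  have diff_bd: "\<bar>k u - k v\<bar> \<le> 2 * K" for u v using bd[of u] bd[of v] by linarith
  have [measurable]: "conv k \<rho> \<in> borel_measurable borel" "S \<in> borel_measurable borel"
    unfolding conv_def S_def D_def by measurable
  have conv_bd: "\<bar>conv k \<rho> x\<bar> \<le> K" for x
    unfolding conv_def using int_bd[of "\<lambda>y. k (x - y)" K] bd by auto
  have S_bd: "\<bar>S x\<bar> \<le> 2 * K" for x
    unfolding S_def D_def using diff_bd K
    by (intro int_bd[THEN conjunct2]) (auto simp: indicator_def)
  have int: "integrable \<rho> (conv k \<rho>)" "integrable \<rho> S"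
    by (auto intro!: int_bd[THEN conjunct1] conv_bd S_bd)
  have ind: "integrable \<rho> (\<lambda>x. indicator B x * (h z - h x))"
    if "h \<in> borel_measurable borel" "\<And>x. \<bar>h x\<bar> \<le> C" for h :: "real \<Rightarrow> real" and C
  proof -
    have "\<bar>indicator B x * (h z - h x)\<bar> \<le> 2 * C" for x
      using that(2)[of x] that(2)[of z] by (auto simp: indicator_def)
    with that(1) show ?thesis by (intro int_bd[THEN conjunct1]) auto
  qed
  have conv_nu: "conv k ?\<nu> = (\<lambda>x. conv k \<rho> x + t * S x)"
    unfolding conv_def S_def D_def
    by (intro ext, subst integral_partial_shift_snd[where K = K]) (use bd in auto)
  have "(LINT x|?\<nu>. conv k ?\<nu> x) = (LINT x|\<rho>. conv k ?\<nu> x) + t * D (conv k ?\<nu>)"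
    unfolding D_def conv_nu
  proof (rule integral_partial_shift_snd)
    show "\<bar>conv k \<rho> x + t * S x\<bar> \<le> K + t * (2 * K)" for x
      using conv_bd[of x] mult_left_mono[OF S_bd[of x] t(1)] t(1)
      by (auto simp: abs_mult intro!: order_trans[OF abs_triangle_ineq])
  qed measurable
  also have "(LINT x|\<rho>. conv k ?\<nu> x) = (LINT x|\<rho>. conv k \<rho> x) + t * (LINT x|\<rho>. S x)"
    unfolding conv_nu using int by simp
  also have "D (conv k ?\<nu>) = D (conv k \<rho>) + t * D S"
  proof -
    have "D (conv k ?\<nu>) = (LINT x|\<rho>. indicator B x * (conv k \<rho> z - conv k \<rho> x)
        + t * (indicator B x * (S z - S x)))"
      unfolding D_def conv_nu by (intro Bochner_Integration.integral_cong) (auto simp: algebra_simps)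
    also have "\<dots> = D (conv k \<rho>) + t * D S"
      unfolding D_def using ind[of "conv k \<rho>" K] ind[of S "2 * K"] conv_bd S_bd by simp
    finally show ?thesis .
  qed
  also have "(LINT x|\<rho>. S x) = D (conv k \<rho>)"
  proof -
    interpret Q: pair_prob_space \<rho> \<rho> ..
    have "(LINT x|\<rho>. S x) = (LINT x|\<rho>. LINT y|\<rho>. indicator B y * (k (x - z) - k (x - y)))"
      unfolding S_def D_def ..
    also have "\<dots> = (LINT y|\<rho>. LINT x|\<rho>. indicator B y * (k (x - z) - k (x - y)))"
    proof (rule Q.Fubini_integral[symmetric])
      have "\<bar>indicator B y * (k (x - z) - k (x - y))\<bar> \<le> 2 * K" for x y
        using diff_bd K by (auto simp: indicator_def)
      then show "integrable (\<rho> \<Otimes>\<^sub>M \<rho>) (\<lambda>(x, y). indicator B y * (k (x - z) - k (x - y)))"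
        by (intro Q.P.integrable_const_bound[of _ "2 * K"]) auto
    qed
    also have "\<dots> = (LINT y|\<rho>. indicator B y * (conv k \<rho> z - conv k \<rho> y))"
    proof (rule Bochner_Integration.integral_cong[OF refl])
      fix y
      have "k (x - z) = k (z - x)" "k (x - y) = k (y - x)" for x
        using sym[of "x - z"] sym[of "x - y"] by simp_all
      moreover have "integrable \<rho> (\<lambda>x. k (w - x))" for w
        using bd by (intro int_bd[THEN conjunct1]) auto
      ultimately show "(LINT x|\<rho>. indicator B y * (k (x - z) - k (x - y))) =
          indicator B y * (conv k \<rho> z - conv k \<rho> y)"
        by (simp add: conv_def)
    qed
    finally show ?thesis by (simp add: D_def)
  qed
  finally have "(LINT x|?\<nu>. conv k ?\<nu> x) = (LINT x|\<rho>. conv k \<rho> x) + 2 * t * D (conv k \<rho>) + t\<^sup>2 * D S"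
    by (simp add: algebra_simps power2_eq_square)
  then show ?thesis
    unfolding interaction_energy_def conv_def[symmetric] S_def by simp
qed

end

section \<open>The potential and its derivative\<close>

lemma continuous_bounded_on_interval:
  fixes f :: "real \<Rightarrow> real"
  assumes "continuous_on UNIV f"
  shows "\<exists>K. \<forall>u\<in>{- A..A}. \<bar>f u\<bar> \<le> K"
proof -
  have "compact (f ` {- A..A})"
    using assms by (intro compact_continuous_image) (auto intro: continuous_on_subset)
  then show ?thesis using compact_imp_bounded by (force simp: bounded_iff)
qed

lemma integrable_continuous_diff:
  fixes f :: "real \<Rightarrow> real"
  assumes sets_rho[measurable_cong]: "sets \<rho> = sets borel" and prob: "prob_space \<rho>"
    and AE_R: "AE y in \<rho>. \<bar>y\<bar> \<le> R" and f: "continuous_on UNIV f"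
  shows "integrable \<rho> (\<lambda>y. f (v - y))"
proof -
  interpret prob_space \<rho> by fact
  have [measurable]: "f \<in> borel_measurable borel" using f by (rule borel_measurable_continuous_onI)
  obtain K where K: "\<And>u. u \<in> {- (\<bar>v\<bar> + R)..\<bar>v\<bar> + R} \<Longrightarrow> \<bar>f u\<bar> \<le> K"
    using continuous_bounded_on_interval[OF f] by blast
  show ?thesis
  proof (rule integrable_const_bound[of _ K])
    show "AE y in \<rho>. norm (f (v - y)) \<le> K"
      using AE_R by eventually_elim (auto intro!: K)
  qed measurable
qed

text \<open>Dominated convergence: the difference quotients of \<open>W\<close> are bounded by the supremum of
  \<open>\<bar>w\<bar>\<close> on a compact interval.\<close>

lemma conv_has_real_derivative:
  fixes W w :: "real \<Rightarrow> real"
  assumes sets_rho[measurable_cong]: "sets \<rho> = sets borel" and prob: "prob_space \<rho>"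
    and AE_R: "AE y in \<rho>. \<bar>y\<bar> \<le> R"
    and deriv: "\<And>x. (W has_real_derivative w x) (at x)" and w: "continuous_on UNIV w"
  shows "(conv W \<rho> has_real_derivative conv w \<rho> x) (at x)"
  unfolding has_field_derivative_iff tendsto_at_iff_sequentially
proof (intro allI impI)
  interpret prob_space \<rho> by fact
  fix X :: "nat \<Rightarrow> real" assume "\<forall>i. X i \<in> UNIV - {x}" and X: "X \<longlonglongrightarrow> x"
  then have X_neq: "X i \<noteq> x" for i by auto
  have W: "continuous_on UNIV W"
    using deriv DERIV_isCont continuous_at_imp_continuous_on by blast
  have [measurable]: "W \<in> borel_measurable borel" "w \<in> borel_measurable borel"
    using W w by (auto intro: borel_measurable_continuous_onI)
  obtain b where b: "\<And>i. \<bar>X i\<bar> \<le> b"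
    using convergent_imp_Bseq[OF convergentI[OF X]] by (auto simp: Bseq_def)
  define A where "A = b + \<bar>x\<bar> + \<bar>R\<bar>"
  obtain K where K: "\<And>u. u \<in> {-A..A} \<Longrightarrow> \<bar>w u\<bar> \<le> K"
    using continuous_bounded_on_interval[OF w] by blast
  have "0 \<le> b" using b[of 0] by linarith
  note int_W = integrable_continuous_diff[OF sets_rho prob AE_R W]
  define q where "q = (\<lambda>i y. (W (X i - y) - W (x - y)) / (X i - x))"
  have q_eq: "(conv W \<rho> (X i) - conv W \<rho> x) / (X i - x) = (LINT y|\<rho>. q i y)" for i
    using int_W by (simp add: conv_def q_def)
  have "(\<lambda>i. LINT y|\<rho>. q i y) \<longlonglongrightarrow> (LINT y|\<rho>. w (x - y))"
  proof (rule integral_dominated_convergence[where w = "\<lambda>_. K"])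
    show "AE y in \<rho>. (\<lambda>i. q i y) \<longlonglongrightarrow> w (x - y)"
    proof (rule AE_I2)
      fix y
      have "((\<lambda>x. x - y) has_real_derivative 1) (at x)"
        by (auto intro!: derivative_eq_intros)
      from DERIV_chain2[OF deriv this]
      have "((\<lambda>x. W (x - y)) has_real_derivative w (x - y)) (at x)" by simp
      then show "(\<lambda>i. q i y) \<longlonglongrightarrow> w (x - y)"
        using X X_neq unfolding has_field_derivative_iff tendsto_at_iff_sequentially
        by (auto simp: comp_def q_def)
    qed
    show "AE y in \<rho>. norm (q i y) \<le> K" for i
      using AE_R
    proof eventually_elim
      case (elim y)
      have seg: "closed_segment (x - y) (X i - y) \<subseteq> {-A..A}"
        using elim b[of i] \<open>0 \<le> b\<close>
        by (intro closed_segment_subset) (auto simp: A_def)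
      have "norm (W (X i - y) - W (x - y)) \<le> K * norm (X i - y - (x - y))"
        using seg K by (intro field_differentiable_bound[of "closed_segment (x - y) (X i - y)" W w])
          (auto intro: has_field_derivative_at_within deriv)
      then show ?case using X_neq[of i] by (simp add: q_def divide_le_eq)
    qed
  qed (auto simp: q_def)
  then show "((\<lambda>y. (conv W \<rho> y - conv W \<rho> x) / (y - x)) \<circ> X) \<longlonglongrightarrow> conv w \<rho> x"
    by (simp add: comp_def q_eq conv_def[of w])
qed

section \<open>Local minimality of the potential on the support\<close>

text \<open>For measures on \<open>[-A, A]\<close> only the values of the kernel on \<open>[-2A, 2A]\<close> matter. This allows
  replacing a continuous kernel by a bounded one.\<close>

lemma interaction_energy_cong:
  fixes W k :: "real \<Rightarrow> real"
  assumes [measurable_cong]: "sets \<mu> = sets borel"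
    and [measurable]: "W \<in> borel_measurable borel" "k \<in> borel_measurable borel"
    and fin: "finite_measure \<mu>"
    and A: "AE x in \<mu>. \<bar>x\<bar> \<le> A" and eq: "\<And>x. \<bar>x\<bar> \<le> 2 * A \<Longrightarrow> W x = k x"
  shows "\<bar>x\<bar> \<le> A \<Longrightarrow> conv W \<mu> x = conv k \<mu> x"
    and "interaction_energy W \<mu> = interaction_energy k \<mu>"
proof -
  interpret finite_measure \<mu> by fact
  show conv: "conv W \<mu> x = conv k \<mu> x" if "\<bar>x\<bar> \<le> A" for x
    unfolding conv_def
  proof (intro integral_cong_AE)
    show "AE y in \<mu>. W (x - y) = k (x - y)"
      using A by eventually_elim (use that in \<open>auto intro!: eq\<close>)
  qed measurable
  have [measurable]: "conv W \<mu> \<in> borel_measurable borel" "conv k \<mu> \<in> borel_measurable borel"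
    unfolding conv_def by measurable
  have "(LINT x|\<mu>. conv W \<mu> x) = (LINT x|\<mu>. conv k \<mu> x)"
    by (intro integral_cong_AE) (use A in \<open>auto elim!: eventually_mono intro: conv\<close>)
  then show "interaction_energy W \<mu> = interaction_energy k \<mu>"
    by (simp add: interaction_energy_def conv_def)
qed

text \<open>The Euler-Lagrange condition. If \<open>\<psi> z < \<psi> x\<close>, then \<open>\<psi> z < \<psi> y - \<delta>\<close> for all \<open>y\<close> in a small ball \<open>B\<close>
  about \<open>x\<close>, which has positive mass. Transporting the fraction \<open>t\<close> of that mass to \<open>z\<close> costs
  less than \<open>\<epsilon>\<close> in \<open>d_inf\<close>, and for small \<open>t\<close> the linear term of the energy change, which is
  negative, dominates the quadratic one.\<close>

lemma d_inf_local_minimizer_imp_local_min: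
  fixes W :: "real \<Rightarrow> real"
  assumes sets_rho[measurable_cong]: "sets \<rho> = sets borel" and prob: "prob_space \<rho>"
    and cont: "continuous_on UNIV W" and sym: "\<And>x. W x = W (- x)"
    and supp: "supp \<rho> \<subseteq> {-R<..<R}"
    and minimizer: "d_inf_local_minimizer W \<rho>"
    and cont_conv: "\<And>x. isCont (conv W \<rho>) x"
  shows "\<exists>\<epsilon>>0. \<forall>x\<in>supp \<rho>. \<forall>z. \<bar>z - x\<bar> < \<epsilon> \<longrightarrow> conv W \<rho> x \<le> conv W \<rho> z"
proof -
  interpret prob_space \<rho> by fact
  obtain \<epsilon> where \<epsilon>: "\<epsilon> > 0" and min: "\<And>\<nu>. \<lbrakk>sets \<nu> = sets borel; prob_space \<nu>; compact (supp \<nu>);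
      d_inf \<rho> \<nu> < ennreal \<epsilon>\<rbrakk> \<Longrightarrow> interaction_energy W \<rho> \<le> interaction_energy W \<nu>"
    using minimizer unfolding d_inf_local_minimizer_def by blast
  have "conv W \<rho> x \<le> conv W \<rho> z" if x: "x \<in> supp \<rho>" and z: "\<bar>z - x\<bar> < \<epsilon>" for x z
  proof (rule ccontr)
    assume "\<not> conv W \<rho> x \<le> conv W \<rho> z"
    define \<delta> where "\<delta> = (conv W \<rho> x - conv W \<rho> z) / 2"
    have \<delta>: "\<delta> > 0" using \<open>\<not> _\<close> by (simp add: \<delta>_def)
    have "\<exists>\<eta>>0. \<forall>y. dist y x < \<eta> \<longrightarrow> dist (conv W \<rho> y) (conv W \<rho> x) < \<delta>"
      using cont_conv[of x] \<delta> unfolding continuous_at_eps_delta by blast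
    then obtain \<eta>0 where \<eta>0: "\<eta>0 > 0"
      "\<And>y. dist y x < \<eta>0 \<Longrightarrow> dist (conv W \<rho> y) (conv W \<rho> x) < \<delta>" by blast
    define \<eta> where "\<eta> = min \<eta>0 ((\<epsilon> - \<bar>z - x\<bar>) / 2)"
    have \<eta>: "\<eta> > 0" "\<bar>z - x\<bar> + \<eta> < \<epsilon>"
    proof -
      have "\<eta> \<le> (\<epsilon> - \<bar>z - x\<bar>) / 2" unfolding \<eta>_def by (rule min.cobounded2)
      with z show "\<bar>z - x\<bar> + \<eta> < \<epsilon>" by argo
    qed (use \<eta>0(1) z in \<open>simp add: \<eta>_def\<close>)
    define B where "B = ball x \<eta>"
    have B[measurable]: "B \<in> sets borel" by (simp add: B_def)
    have conv_B: "conv W \<rho> z - conv W \<rho> y \<le> - \<delta>" if "y \<in> B" for y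
    proof -
      have "\<bar>conv W \<rho> y - conv W \<rho> x\<bar> < \<delta>"
        using \<eta>0(2)[of y] that by (simp add: B_def \<eta>_def dist_commute dist_real_def)
      moreover have "conv W \<rho> x = conv W \<rho> z + 2 * \<delta>" by (simp add: \<delta>_def field_simps)
      ultimately show ?thesis by linarith
    qed
    define m where "m = measure \<rho> B"
    have m: "m > 0"
    proof -
      have "emeasure \<rho> B > 0" using x \<eta> by (auto simp: supp_def B_def)
      then show ?thesis by (simp add: m_def emeasure_eq_measure)
    qed
    define A where "A = R + \<bar>z\<bar>"
    have AE_R: "AE y in \<rho>. \<bar>y\<bar> < R"
      using AE_in_supp[OF sets_rho]
    proof eventually_elim
      case (elim y)
      then have "y \<in> {-R<..<R}" using supp by blast
      then show ?case by auto
    qed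
    have "R > 0" using supp x by force
    then have A: "A > 0" by (simp add: A_def)
    \<comment> \<open>All measures below live on \<open>[-A, A]\<close>, so that the kernel may be cut off to a bounded one.\<close>
    define k where "k = (\<lambda>u. W (max (- 2 * A) (min (2 * A) u)))"
    have W_meas[measurable]: "W \<in> borel_measurable borel"
      using cont by (rule borel_measurable_continuous_onI)
    have k_meas[measurable]: "k \<in> borel_measurable borel" unfolding k_def by measurable
    have k_sym: "k (- u) = k u" for u
    proof -
      have "max (- 2 * A) (min (2 * A) (- u)) = - max (- 2 * A) (min (2 * A) u)"
        using A by (auto simp: max_def min_def)
      then show ?thesis unfolding k_def using sym by metis
    qed
    obtain K where "\<And>u. u \<in> {- (2 * A)..2 * A} \<Longrightarrow> \<bar>W u\<bar> \<le> K"
      using continuous_bounded_on_interval[OF cont] by blast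
    then have K: "\<bar>k u\<bar> \<le> K" for u using A unfolding k_def by (auto simp: max_def min_def)
    have k_eq: "W u = k u" if "\<bar>u\<bar> \<le> 2 * A" for u
      unfolding k_def using that by (auto simp: max_def min_def abs_le_iff intro!: arg_cong[of _ _ W])
    have AE_A: "AE y in \<rho>. \<bar>y\<bar> \<le> A" using AE_R by eventually_elim (simp add: A_def)
    define D where "D = (LINT y|\<rho>. indicator B y * (conv k \<rho> z - conv k \<rho> y))"
    have [measurable]: "conv W \<rho> \<in> borel_measurable borel" "conv k \<rho> \<in> borel_measurable borel"
      unfolding conv_def by measurable
    have conv_k: "conv W \<rho> y = conv k \<rho> y" if "\<bar>y\<bar> \<le> A" for y
      using interaction_energy_cong(1)[OF sets_rho W_meas k_meas finite_measure_axioms AE_A k_eq] that by simp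
    have D: "D \<le> - (\<delta> * m)"
    proof -
      have "\<bar>conv k \<rho> y\<bar> \<le> K" for y
      proof -
        have "integrable \<rho> (\<lambda>v. k (y - v))" by (rule integrable_const_bound[of _ K]) (use K in auto)
        then have "(LINT v|\<rho>. \<bar>k (y - v)\<bar>) \<le> (LINT v|\<rho>. K)" using K by (intro integral_mono) auto
        then have "(LINT v|\<rho>. \<bar>k (y - v)\<bar>) \<le> K" by (simp add: prob_space)
        moreover have "\<bar>LINT v|\<rho>. k (y - v)\<bar> \<le> (LINT v|\<rho>. \<bar>k (y - v)\<bar>)"
          by (rule integral_abs_bound)
        ultimately show ?thesis unfolding conv_def by (rule order_trans[rotated])
      qed
      then have bd: "\<bar>conv k \<rho> z - conv k \<rho> y\<bar> \<le> 2 * K" for y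
        using abs_triangle_ineq4[of "conv k \<rho> z" "conv k \<rho> y"] by (smt (verit))
      have "K \<ge> 0" using K[of 0] by linarith
      with bd have "integrable \<rho> (\<lambda>y. indicator B y * (conv k \<rho> z - conv k \<rho> y))"
        by (intro integrable_const_bound[of _ "2 * K"]) (auto simp: indicator_def)
      moreover have "AE y in \<rho>. indicator B y * (conv k \<rho> z - conv k \<rho> y) \<le> indicator B y * (- \<delta>)"
        using AE_A
      proof eventually_elim
        case (elim y)
        have "\<bar>z\<bar> \<le> A" using \<open>R > 0\<close> by (simp add: A_def)
        then show ?case using conv_B[of y] conv_k[of y] conv_k[of z] elim by (auto simp: indicator_def)
      qed
      moreover have "integrable \<rho> (\<lambda>y. indicator B y * (- \<delta>))"
        by (rule integrable_const_bound[of _ \<delta>]) (use \<delta> in \<open>auto simp: indicator_def\<close>)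
      ultimately have "D \<le> (LINT y|\<rho>. indicator B y * (- \<delta>))"
        unfolding D_def by (intro integral_mono_AE)
      also have "\<dots> = - (\<delta> * m)"
        using sets_eq_imp_space_eq[OF sets_rho] by (simp add: m_def)
      finally show ?thesis .
    qed
    define q where "q = (LINT x|\<rho>. indicator B x * ((LINT y|\<rho>. indicator B y * (k (z - z) - k (z - y))) -
        (LINT y|\<rho>. indicator B y * (k (x - z) - k (x - y))))) / 2"
    have q: "\<delta> * m \<le> t * q" if t: "0 < t" "t \<le> 1" for t
    proof -
      let ?\<pi> = "partial_shift \<rho> B z t"
      let ?\<nu> = "distr ?\<pi> borel snd"
      have t0: "0 \<le> t" using t by simp
      note shift = prob sets_rho B t0 t(2)
      have plan: "?\<pi> \<in> transport_plans \<rho> ?\<nu>"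
        by (rule transport_plan_partial_shift[OF shift])
      then have sets_pi[measurable_cong]: "sets ?\<pi> = sets borel" and prob_pi: "prob_space ?\<pi>"
        by (auto simp: transport_plans_def)
      have AE_pi: "AE p in ?\<pi>. \<bar>fst p - snd p\<bar> \<le> \<bar>z - x\<bar> + \<eta> \<and> \<bar>snd p\<bar> \<le> A"
      proof (rule AE_partial_shift[OF shift])
        show "AE y in \<rho>. (\<bar>fst (y, y) - snd (y, y)\<bar> \<le> \<bar>z - x\<bar> + \<eta> \<and> \<bar>snd (y, y)\<bar> \<le> A) \<and>
          (y \<in> B \<longrightarrow> \<bar>fst (y, z) - snd (y, z)\<bar> \<le> \<bar>z - x\<bar> + \<eta> \<and> \<bar>snd (y, z)\<bar> \<le> A)"
          using AE_R by eventually_elim (use \<eta>(1) in \<open>auto simp: A_def B_def dist_real_def\<close>)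
        show "Measurable.pred borel (\<lambda>p :: real \<times> real. \<bar>fst p - snd p\<bar> \<le> \<bar>z - x\<bar> + \<eta> \<and> \<bar>snd p\<bar> \<le> A)"
          by measurable
      qed
      have snd_meas: "snd \<in> ?\<pi> \<rightarrow>\<^sub>M borel"
        using sets_pi by (simp add: measurable_cong_sets[OF sets_pi refl]
            borel_measurable_continuous_onI continuous_on_snd)
      have AE_nu: "AE y in ?\<nu>. \<bar>y\<bar> \<le> A"
        by (subst AE_distr_iff[OF snd_meas]) (use AE_pi in \<open>auto elim!: eventually_mono\<close>)
      have sets_nu: "sets ?\<nu> = sets borel" by simp
      have prob_nu: "prob_space ?\<nu>" using prob_space.prob_space_distr[OF prob_pi snd_meas] .
      have "supp ?\<nu> \<subseteq> cball 0 A"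
        using AE_nu by (intro supp_subset_closed) (auto elim!: eventually_mono)
      then have "compact (supp ?\<nu>)"
        using closed_supp bounded_subset bounded_cball compact_eq_bounded_closed by blast
      moreover have "d_inf \<rho> ?\<nu> < ennreal \<epsilon>"
      proof -
        have "supp ?\<pi> \<subseteq> {p. \<bar>fst p - snd p\<bar> \<le> \<bar>z - x\<bar> + \<eta>}"
          using AE_pi by (intro supp_subset_closed sets_pi closed_Collect_le)
            (auto elim!: eventually_mono intro!: continuous_intros)
        then have "(SUP (x, y)\<in>supp ?\<pi>. ennreal \<bar>x - y\<bar>) \<le> ennreal (\<bar>z - x\<bar> + \<eta>)"
          by (intro SUP_least) (auto intro!: ennreal_leI)
        then have "d_inf \<rho> ?\<nu> \<le> ennreal (\<bar>z - x\<bar> + \<eta>)"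
          unfolding d_inf_def by (rule INF_lower2[OF plan])
        also have "\<dots> < ennreal \<epsilon>" using \<eta> by (intro ennreal_lessI) auto
        finally show ?thesis .
      qed
      ultimately have "interaction_energy W \<rho> \<le> interaction_energy W ?\<nu>"
        using min[OF sets_nu prob_nu] by blast
      moreover have "interaction_energy W \<rho> = interaction_energy k \<rho>"
        by (rule interaction_energy_cong(2)[OF sets_rho W_meas k_meas finite_measure_axioms AE_A k_eq])
      moreover have "interaction_energy W ?\<nu> = interaction_energy k ?\<nu>"
        by (rule interaction_energy_cong(2)[OF sets_nu W_meas k_meas _ AE_nu k_eq])
          (rule prob_space.finite_measure[OF prob_nu])
      moreover have "interaction_energy k ?\<nu> = interaction_energy k \<rho> + t * D + t\<^sup>2 * q"
        unfolding D_def q_def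
        by (rule interaction_energy_partial_shift[OF shift k_meas K k_sym])
      ultimately have "0 \<le> t * (D + t * q)" by (simp add: algebra_simps power2_eq_square)
      then have "0 \<le> D + t * q" using t(1) by (simp add: zero_le_mult_iff)
      with D show ?thesis by linarith
    qed
    have dm: "\<delta> * m > 0" using \<delta> m by simp
    \<comment> \<open>This \<open>t\<close> makes \<open>t * q\<close> at most half of the required lower bound \<open>\<delta> * m\<close>.\<close>
    define t where "t = min 1 (\<delta> * m / (2 * (\<bar>q\<bar> + 1)))"
    have t: "0 < t" "t \<le> 1" using dm by (auto simp: t_def intro!: divide_pos_pos add_nonneg_pos)
    have "t * q \<le> t * (\<bar>q\<bar> + 1)" using t(1) by (intro mult_left_mono) auto
    also have "\<dots> \<le> \<delta> * m / (2 * (\<bar>q\<bar> + 1)) * (\<bar>q\<bar> + 1)"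
      by (intro mult_right_mono) (auto simp: t_def)
    also have "\<dots> = \<delta> * m / 2" by (simp add: field_simps add_pos_nonneg)
    finally show False using q[OF t] dm by linarith
  qed
  with \<epsilon> show ?thesis by blast
qed

section \<open>Divided differences\<close>

text \<open>The mean value theorem for the third divided difference at the nodes \<open>x\<close>, \<open>x + a\<close>,
  \<open>x + a + b\<close>, \<open>x + a + b + c\<close>, multiplied by the product of all differences of the nodes to
  avoid division. The left-hand side is linear in \<open>f\<close>, so it may be integrated with respect to a
  parameter, and \<open>f\<close> is differentiated only in the open interval, so that the singularity of the
  kernel may sit at an end point.\<close>

lemma third_divided_difference_mean_value:
  fixes f f1 f2 f3 :: "real \<Rightarrow> real"
  assumes pos: "0 < a" "0 < b" "0 < c" and cont: "continuous_on {x..x + a + b + c} f"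
    and f1: "\<And>t. x < t \<Longrightarrow> t < x + a + b + c \<Longrightarrow> (f has_real_derivative f1 t) (at t)"
    and f2: "\<And>t. x < t \<Longrightarrow> t < x + a + b + c \<Longrightarrow> (f1 has_real_derivative f2 t) (at t)"
    and f3: "\<And>t. x < t \<Longrightarrow> t < x + a + b + c \<Longrightarrow> (f2 has_real_derivative f3 t) (at t)"
  shows "\<exists>t. x < t \<and> t < x + a + b + c \<and>
    - (b * c * (b + c)) * f x + (a + b) * c * (a + b + c) * f (x + a)
      - a * (b + c) * (a + b + c) * f (x + a + b) + a * b * (a + b) * f (x + a + b + c)
    = a * b * c * (a + b) * (b + c) * (a + b + c) * (f3 t / 6)"
proof -
  define \<Lambda> where "\<Lambda> = - (b * c * (b + c)) * f x + (a + b) * c * (a + b + c) * f (x + a)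
      - a * (b + c) * (a + b + c) * f (x + a + b) + a * b * (a + b) * f (x + a + b + c)"
  define V where "V = a * b * c * (a + b) * (b + c) * (a + b + c)"
  have V: "V > 0" using pos by (simp add: V_def)
  define D where "D = \<Lambda> / V"
  have D: "D * V = \<Lambda>" using V by (simp add: D_def)
  \<comment> \<open>The coefficients of the Newton interpolation polynomial; the leading one is \<open>D\<close>.\<close>
  define \<beta> where "\<beta> = (f (x + a) - f x) / a"
  define \<gamma> where "\<gamma> = (f (x + a + b) - f x - \<beta> * (a + b)) / ((a + b) * b)"
  have \<beta>: "f (x + a) = f x + \<beta> * a" using pos by (simp add: \<beta>_def)
  have \<gamma>: "f (x + a + b) = f x + \<beta> * (a + b) + \<gamma> * ((a + b) * b)" using pos by (simp add: \<gamma>_def)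
  have "a * b * (a + b) * (f (x + a + b + c) -
      (f x + \<beta> * (a + b + c) + \<gamma> * (a + b + c) * (b + c) + D * (a + b + c) * (b + c) * c)) = 0"
    using D unfolding \<Lambda>_def V_def \<beta> \<gamma> by (simp add: algebra_simps)
  then have \<delta>: "f (x + a + b + c) =
      f x + \<beta> * (a + b + c) + \<gamma> * (a + b + c) * (b + c) + D * (a + b + c) * (b + c) * c"
    using pos by simp
  \<comment> \<open>The error of the cubic Newton interpolation polynomial, and its derivatives.\<close>
  define h where "h = (\<lambda>t. f t - (f x + \<beta> * (t - x) + \<gamma> * (t - x) * (t - x - a)
      + D * (t - x) * (t - x - a) * (t - x - a - b)))"
  define h1 where "h1 = (\<lambda>t. f1 t - (\<beta> + \<gamma> * (2 * (t - x) - a)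
      + D * (3 * (t - x)\<^sup>2 - (4 * a + 2 * b) * (t - x) + a * (a + b))))"
  define h2 where "h2 = (\<lambda>t. f2 t - (2 * \<gamma> + D * (6 * (t - x) - (4 * a + 2 * b))))"
  have zeros: "h x = 0" "h (x + a) = 0" "h (x + a + b) = 0" "h (x + a + b + c) = 0"
    unfolding h_def \<beta> \<gamma> \<delta> by (simp_all add: algebra_simps)
  have d1: "(h has_real_derivative h1 t) (at t)" if "x < t" "t < x + a + b + c" for t
    unfolding h_def h1_def using f1[OF that]
    by (auto intro!: derivative_eq_intros simp: algebra_simps power2_eq_square)
  have d2: "(h1 has_real_derivative h2 t) (at t)" if "x < t" "t < x + a + b + c" for t
    unfolding h1_def h2_def using f2[OF that]
    by (auto intro!: derivative_eq_intros simp: algebra_simps)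
  have d3: "(h2 has_real_derivative f3 t - 6 * D) (at t)" if "x < t" "t < x + a + b + c" for t
    unfolding h2_def using f3[OF that] by (auto intro!: derivative_eq_intros simp: algebra_simps)
  have cont_h: "continuous_on {x..x + a + b + c} h"
    unfolding h_def by (intro continuous_intros cont)
  have rolle: "\<exists>t. u < t \<and> t < v \<and> k t = 0"
    if uv: "u < v" "g u = g v" "continuous_on {u..v} g"
      "\<And>t. u < t \<Longrightarrow> t < v \<Longrightarrow> (g has_real_derivative k t) (at t)"
    for u v :: real and g k :: "real \<Rightarrow> real"
  proof -
    obtain t where t: "u < t" "t < v" "DERIV g t :> 0"
      using Rolle[OF uv(1-3)] uv(4) real_differentiable_def by blast
    with uv(4)[of t] show ?thesis using DERIV_unique by blast
  qed
  have sub: "continuous_on {u..v} g"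
    if "x < u" "v < x + a + b + c" "\<And>t. x < t \<Longrightarrow> t < x + a + b + c \<Longrightarrow> (g has_real_derivative k t) (at t)"
    for u v and g k :: "real \<Rightarrow> real"
    using that(1,2) by (intro continuous_at_imp_continuous_on ballI DERIV_isCont[OF that(3)]) auto
  obtain t1 where t1: "x < t1" "t1 < x + a" "h1 t1 = 0"
    using rolle[of x "x + a" h h1] zeros pos d1 continuous_on_subset[OF cont_h, of "{x..x + a}"] by force
  obtain t2 where t2: "x + a < t2" "t2 < x + a + b" "h1 t2 = 0"
    using rolle[of "x + a" "x + a + b" h h1] zeros pos d1
      continuous_on_subset[OF cont_h, of "{x + a..x + a + b}"] by force
  obtain t3 where t3: "x + a + b < t3" "t3 < x + a + b + c" "h1 t3 = 0"
    using rolle[of "x + a + b" "x + a + b + c" h h1] zeros pos d1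
      continuous_on_subset[OF cont_h, of "{x + a + b..x + a + b + c}"] by force
  obtain s1 where s1: "t1 < s1" "s1 < t2" "h2 s1 = 0"
    using rolle[of t1 t2 h1 h2] t1 t2 t3 d2 sub[of t1 t2 h1 h2] by force
  obtain s2 where s2: "t2 < s2" "s2 < t3" "h2 s2 = 0"
    using rolle[of t2 t3 h1 h2] t1 t2 t3 d2 sub[of t2 t3 h1 h2] pos by force
  obtain \<xi> where \<xi>: "s1 < \<xi>" "\<xi> < s2" "f3 \<xi> - 6 * D = 0"
    using rolle[of s1 s2 h2 "\<lambda>t. f3 t - 6 * D"] s1 s2 t1 t2 t3 d3 sub[of s1 s2 h2 "\<lambda>t. f3 t - 6 * D"]
      pos by force
  then have "\<Lambda> = V * (f3 \<xi> / 6)" using D by (simp add: mult.commute)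
  moreover have "x < \<xi>" "\<xi> < x + a + b + c" using \<xi> s1 s2 t1 t3 by linarith+
  ultimately show ?thesis unfolding \<Lambda>_def V_def by blast
qed

section \<open>Derivatives of the singular kernel\<close>

lemma DERIV_abs_powr:
  fixes t p :: real
  assumes "t \<noteq> 0"
  shows "((\<lambda>t. \<bar>t\<bar> powr p) has_real_derivative p * (sgn t * \<bar>t\<bar> powr (p - 1))) (at t)"
proof -
  have "((\<lambda>t. \<bar>t\<bar> powr p) has_real_derivative p * \<bar>t\<bar> powr (p - 1) * sgn t) (at t)"
  proof (rule has_real_derivative_powr[THEN DERIV_chain2])
    show "(abs has_real_derivative sgn t) (at t)"
    proof (cases "t > 0")
      case True
      then have "eventually (\<lambda>u. \<bar>u\<bar> = u) (nhds t)"
        by (intro eventually_mono[OF eventually_nhds_in_open[of "{0<..}" t]]) auto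
      then show ?thesis using True DERIV_cong_ev[OF refl _ refl, of abs "\<lambda>u. u" t 1] by simp
    next
      case False
      with assms have "t < 0" by simp
      then have "eventually (\<lambda>u. \<bar>u\<bar> = - u) (nhds t)"
        by (intro eventually_mono[OF eventually_nhds_in_open[of "{..<0}" t]]) auto
      then show ?thesis using \<open>t < 0\<close> DERIV_cong_ev[OF refl _ refl, of abs uminus t "- 1"] DERIV_minus[OF DERIV_ident]
        by simp
    qed
  qed (use assms in auto)
  then show ?thesis by (simp add: mult_ac)
qed

lemma DERIV_sgn_abs_powr:
  fixes t p :: real
  assumes "t \<noteq> 0"
  shows "((\<lambda>t. sgn t * \<bar>t\<bar> powr p) has_real_derivative p * \<bar>t\<bar> powr (p - 1)) (at t)"
proof -
  have "eventually (\<lambda>u. sgn u = sgn t) (nhds t)"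
  proof (cases "t > 0")
    case True
    then show ?thesis by (intro eventually_mono[OF eventually_nhds_in_open[of "{0<..}" t]]) auto
  next
    case False
    with assms show ?thesis by (intro eventually_mono[OF eventually_nhds_in_open[of "{..<0}" t]]) auto
  qed
  then have ev: "eventually (\<lambda>u. sgn u * \<bar>u\<bar> powr p = sgn t * \<bar>u\<bar> powr p) (nhds t)"
    by eventually_elim simp
  have "((\<lambda>u. sgn t * \<bar>u\<bar> powr p) has_real_derivative sgn t * (p * (sgn t * \<bar>t\<bar> powr (p - 1)))) (at t)"
    using DERIV_abs_powr[OF assms] by (rule DERIV_cmult)
  moreover have "sgn t * (p * (sgn t * \<bar>t\<bar> powr (p - 1))) = p * \<bar>t\<bar> powr (p - 1)"
    using assms by (simp add: sgn_if)
  ultimately show ?thesis using DERIV_cong_ev[OF refl ev refl] by metis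
qed

text \<open>For \<open>p > 1\<close> the power is differentiable at the origin as well.\<close>

lemma DERIV_abs_powr_all:
  fixes t p :: real
  assumes "1 < p"
  shows "((\<lambda>t. \<bar>t\<bar> powr p) has_real_derivative p * (sgn t * \<bar>t\<bar> powr (p - 1))) (at t)"
proof (cases "t = 0")
  case True
  have "((\<lambda>h. \<bar>h\<bar> powr p / h) \<longlongrightarrow> 0) (at (0::real))"
  proof (rule Lim_null_comparison)
    show "\<forall>\<^sub>F h in at 0. norm (\<bar>h\<bar> powr p / h) \<le> \<bar>h\<bar> powr (p - 1)"
      by (rule eventually_mono[OF eventually_at_topological[THEN iffD2]])
        (auto simp: powr_diff intro!: exI[of _ UNIV])
    have "((\<lambda>h. \<bar>h\<bar> powr (p - 1)) \<longlongrightarrow> \<bar>0\<bar> powr (p - 1)) (at (0::real))"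
      using assms by (intro tendsto_powr' tendsto_intros) auto
    then show "((\<lambda>h. \<bar>h\<bar> powr (p - 1)) \<longlongrightarrow> 0) (at (0::real))" by simp
  qed
  then show ?thesis using True by (simp add: has_field_derivative_iff)
next
  case False
  then show ?thesis by (rule DERIV_abs_powr)
qed

lemma continuous_on_sgn_abs_powr:
  fixes p :: real
  assumes "0 < p"
  shows "continuous_on S (\<lambda>t. sgn t * \<bar>t\<bar> powr p)"
proof (intro continuous_at_imp_continuous_on ballI)
  fix t :: real
  show "isCont (\<lambda>t. sgn t * \<bar>t\<bar> powr p) t"
  proof (cases "t = 0")
    case True
    have "((\<lambda>h. sgn h * \<bar>h\<bar> powr p) \<longlongrightarrow> 0) (at (0::real))"
    proof (rule Lim_null_comparison)
      show "\<forall>\<^sub>F h in at 0. norm (sgn h * \<bar>h\<bar> powr p) \<le> \<bar>h\<bar> powr p"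
        by (rule always_eventually) (auto simp: abs_mult sgn_if)
      have "((\<lambda>h. \<bar>h\<bar> powr p) \<longlongrightarrow> \<bar>0\<bar> powr p) (at (0::real))"
        using assms by (intro tendsto_powr' tendsto_intros) auto
      then show "((\<lambda>h. \<bar>h\<bar> powr p) \<longlongrightarrow> 0) (at (0::real))" by simp
    qed
    then show ?thesis using True by (simp add: isCont_def)
  next
    case False
    then show ?thesis using DERIV_sgn_abs_powr DERIV_isCont by blast
  qed
qed

lemma sgn_abs_powr_mono:
  fixes p s t :: real
  assumes "0 \<le> p" "s \<le> t"
  shows "sgn s * \<bar>s\<bar> powr p \<le> sgn t * \<bar>t\<bar> powr p"
proof -
  consider "0 \<le> s" | "t \<le> 0" | "s < 0" "0 < t" by linarith
  then show ?thesis
  proof cases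
    case 1
    then show ?thesis using assms powr_mono2[of p s t] by (auto simp: sgn_if)
  next
    case 2
    then show ?thesis using assms powr_mono2[of p "- t" "- s"] by (auto simp: sgn_if)
  next
    case 3
    then show ?thesis by (simp add: sgn_if order_trans[of _ 0])
  qed
qed

lemma singular_kernel_derivative:
  fixes W W1 D1 :: "real \<Rightarrow> real"
  assumes b: "1 < b" and W: "\<And>x. W x = - (\<bar>x\<bar> powr b / b) + W1 x"
    and D1: "\<And>t. (W1 has_real_derivative D1 t) (at t)" and cont: "continuous_on UNIV D1"
  shows "(W has_real_derivative - (sgn t * \<bar>t\<bar> powr (b - 1)) + D1 t) (at t)"
    and "continuous_on UNIV (\<lambda>t. - (sgn t * \<bar>t\<bar> powr (b - 1)) + D1 t)"
proof -
  have "((\<lambda>x. - (\<bar>x\<bar> powr b / b) + W1 x) has_real_derivative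
      - (b * (sgn t * \<bar>t\<bar> powr (b - 1)) / b) + D1 t) (at t)"
    using b by (intro DERIV_add DERIV_minus DERIV_cdivide DERIV_abs_powr_all D1) auto
  moreover have "W = (\<lambda>x. - (\<bar>x\<bar> powr b / b) + W1 x)" using W by blast
  ultimately show "(W has_real_derivative - (sgn t * \<bar>t\<bar> powr (b - 1)) + D1 t) (at t)"
    using b by simp
  show "continuous_on UNIV (\<lambda>t. - (sgn t * \<bar>t\<bar> powr (b - 1)) + D1 t)"
    using b cont by (intro continuous_intros continuous_on_sgn_abs_powr) auto
qed

section \<open>The support contains an interval\<close>

text \<open>For \<open>y\<close> outside the gap, the mean value theorem bounds the third difference of
  \<open>x \<mapsto> w (x - y)\<close> by a value of \<open>w'''\<close>. This is at most \<open>K\<close> for every \<open>y\<close> in \<open>[-R, R]\<close>, and even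
  at most \<open>K - \<kappa>\<close> if \<open>y\<close> lies in the interval \<open>[u, u + l]\<close> around the gap; integrating over \<open>y\<close> gives a negative
  multiple of \<open>\<kappa> \<rho>[u, u + l] - K\<close>.\<close>

lemma conv_third_difference_neg:
  fixes w w1 w2 w3 :: "real \<Rightarrow> real" and a b c x R u l K \<kappa> :: real
  assumes sets_rho[measurable_cong]: "sets \<rho> = sets borel" and prob: "prob_space \<rho>"
    and pos: "0 < a" "0 < b" "0 < c" and w: "continuous_on UNIV w"
    and w1: "\<And>t. t \<noteq> 0 \<Longrightarrow> (w has_real_derivative w1 t) (at t)"
    and w2: "\<And>t. t \<noteq> 0 \<Longrightarrow> (w1 has_real_derivative w2 t) (at t)"
    and w3: "\<And>t. t \<noteq> 0 \<Longrightarrow> (w2 has_real_derivative w3 t) (at t)"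
    and AE_R: "AE y in \<rho>. \<bar>y\<bar> \<le> R" and gap: "AE y in \<rho>. y \<notin> {x<..<x + a + b + c}"
    and sub: "{x..x + a + b + c} \<subseteq> {- R..R}" "{x..x + a + b + c} \<subseteq> {u..u + l}"
    and w3_le: "\<And>t. t \<noteq> 0 \<Longrightarrow> \<bar>t\<bar> \<le> 2 * R \<Longrightarrow> w3 t \<le> K"
    and w3_le': "\<And>t. t \<noteq> 0 \<Longrightarrow> \<bar>t\<bar> \<le> 2 * R \<Longrightarrow> \<bar>t\<bar> \<le> l \<Longrightarrow> w3 t \<le> K - \<kappa>"
    and mass: "K < \<kappa> * measure \<rho> {u..u + l}"
  shows "- (b * c * (b + c)) * conv w \<rho> x + (a + b) * c * (a + b + c) * conv w \<rho> (x + a)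
      - a * (b + c) * (a + b + c) * conv w \<rho> (x + a + b)
      + a * b * (a + b) * conv w \<rho> (x + a + b + c) < 0"
proof -
  interpret prob_space \<rho> by fact
  define \<Lambda> where "\<Lambda> = (\<lambda>f :: real \<Rightarrow> real.
      - (b * c * (b + c)) * f x + (a + b) * c * (a + b + c) * f (x + a)
      - a * (b + c) * (a + b + c) * f (x + a + b) + a * b * (a + b) * f (x + a + b + c))"
  define V where "V = a * b * c * (a + b) * (b + c) * (a + b + c)"
  have V: "V > 0" using pos by (simp add: V_def)
  note int = integrable_continuous_diff[OF sets_rho prob AE_R w]
  have ints: "integrable \<rho> (\<lambda>y. w (x - y))" "integrable \<rho> (\<lambda>y. w (x + a - y))"
    "integrable \<rho> (\<lambda>y. w (x + a + b - y))" "integrable \<rho> (\<lambda>y. w (x + a + b + c - y))"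
    by (rule int)+
  have "\<Lambda> (conv w \<rho>) = (LINT y|\<rho>. \<Lambda> (\<lambda>t. w (t - y)))"
    unfolding \<Lambda>_def conv_def using ints by simp
  also have "\<dots> \<le> (LINT y|\<rho>. V / 6 * (K - \<kappa> * indicator {u..u + l} y))"
  proof (rule integral_mono_AE)
    show "integrable \<rho> (\<lambda>y. \<Lambda> (\<lambda>t. w (t - y)))" unfolding \<Lambda>_def using ints by simp
    show "integrable \<rho> (\<lambda>y. V / 6 * (K - \<kappa> * indicator {u..u + l} y))"
      by (auto simp: sets_rho emeasure_eq_measure)
    show "AE y in \<rho>. \<Lambda> (\<lambda>t. w (t - y)) \<le> V / 6 * (K - \<kappa> * indicator {u..u + l} y)"
      using AE_R gap
    proof eventually_elim
      case (elim y)
      have shift: "((\<lambda>t. f (t - y)) has_real_derivative f' (t - y)) (at t)"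
        if "(f has_real_derivative f' (t - y)) (at (t - y))" for f f' :: "real \<Rightarrow> real" and t
        using that by (simp add: DERIV_shift[of f _ t "- y", simplified])
      have ne: "t - y \<noteq> 0" if "x < t" "t < x + a + b + c" for t using elim(2) that by auto
      have "\<exists>t. x < t \<and> t < x + a + b + c \<and> \<Lambda> (\<lambda>t. w (t - y)) = V * (w3 (t - y) / 6)"
        unfolding \<Lambda>_def V_def
      proof (rule third_divided_difference_mean_value[OF pos])
        show "continuous_on {x..x + a + b + c} (\<lambda>t. w (t - y))"
          by (rule continuous_on_compose2[OF w]) (auto intro!: continuous_intros)
      next
        fix t assume "x < t" "t < x + a + b + c"
        note t = ne[OF this]
        show "((\<lambda>t. w (t - y)) has_real_derivative w1 (t - y)) (at t)" by (rule shift) (rule w1[OF t])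
        show "((\<lambda>t. w1 (t - y)) has_real_derivative w2 (t - y)) (at t)" by (rule shift) (rule w2[OF t])
        show "((\<lambda>t. w2 (t - y)) has_real_derivative w3 (t - y)) (at t)" by (rule shift) (rule w3[OF t])
      qed
      then obtain t where t: "x < t" "t < x + a + b + c" "\<Lambda> (\<lambda>t. w (t - y)) = V * (w3 (t - y) / 6)"
        by blast
      have "t \<in> {x..x + a + b + c}" using t by simp
      then have tR: "t \<in> {- R..R}" and tJ: "t \<in> {u..u + l}" using sub by blast+
      have "w3 (t - y) \<le> K - \<kappa> * indicator {u..u + l} y"
        using w3_le[OF ne[OF t(1,2)]] w3_le'[OF ne[OF t(1,2)]] tR tJ elim(1)
        by (auto simp: indicator_def abs_le_iff)
      then have "V * w3 (t - y) \<le> V * (K - \<kappa> * indicator {u..u + l} y)"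
        using V by (intro mult_left_mono) auto
      then show ?case using t(3) by simp
    qed
  qed
  also have "\<dots> = V / 6 * (K - \<kappa> * measure \<rho> {u..u + l})"
    using sets_eq_imp_space_eq[OF sets_rho] prob_space
    by (simp add: sets_rho emeasure_eq_measure)
  also have "\<dots> < 0" using V mass by (simp add: mult_pos_neg)
  finally show ?thesis by (simp add: \<Lambda>_def)
qed

text \<open>The heart of the argument. The interval \<open>[u, u + l]\<close> is so short, for the mass it
  carries, that the singular part of the kernel dominates the smooth part there. So the support has no
  gaps in it, and the remaining interval cannot be shorter than \<open>c0\<close>.\<close>

lemma support_contains_interval:
  fixes W W1 D1 D2 D3 D4 :: "real \<Rightarrow> real" and b R C m u l c0 \<epsilon> :: real
  assumes b: "1 < b" "b < 2"
    and sets_rho[measurable_cong]: "sets \<rho> = sets borel" and prob: "prob_space \<rho>"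
    and supp: "supp \<rho> \<subseteq> {-R<..<R}"
    and W: "\<And>x. W x = - (\<bar>x\<bar> powr b / b) + W1 x"
    and D1: "\<And>t. (W1 has_real_derivative D1 t) (at t)"
    and D2: "\<And>t. (D1 has_real_derivative D2 t) (at t)"
    and D3: "\<And>t. (D2 has_real_derivative D3 t) (at t)"
    and D4: "\<And>t. (D3 has_real_derivative D4 t) (at t)"
    and D2_le: "\<And>t. \<bar>t\<bar> \<le> 2 * R \<Longrightarrow> D2 t \<le> C" and D4_le: "\<And>t. \<bar>t\<bar> \<le> 2 * R \<Longrightarrow> D4 t \<le> C"
    and \<epsilon>: "\<epsilon> > 0" and loc_min: "\<And>x z. x \<in> supp \<rho> \<Longrightarrow> \<bar>z - x\<bar> < \<epsilon> \<Longrightarrow> conv W \<rho> x \<le> conv W \<rho> z"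
    and l: "l > 0" and m: "m > 0" and mass: "m \<le> measure \<rho> {u..u + l}"
    and C_less: "C < (b - 1) * (2 - b) * (3 - b) * l powr (b - 4) * m"
    and c0: "c0 > 0" "\<And>s. 0 < s \<Longrightarrow> s < c0 \<Longrightarrow> C * s < m * (s / 2) powr (b - 1)"
  shows "\<exists>p q. p + c0 \<le> q \<and> {p..q} \<subseteq> supp \<rho>"
proof -
  interpret prob_space \<rho> by fact
  define \<kappa> where "\<kappa> = (b - 1) * (2 - b) * (3 - b) * l powr (b - 4)"
  \<comment> \<open>The derivatives of \<open>W\<close> of orders 1 to 4, of which only the first exists at the origin.\<close>
  define w where "w = (\<lambda>t. - (sgn t * \<bar>t\<bar> powr (b - 1)) + D1 t)"
  define w1 where "w1 = (\<lambda>t. - ((b - 1) * \<bar>t\<bar> powr (b - 2)) + D2 t)"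
  define w2 where "w2 = (\<lambda>t. - ((b - 1) * ((b - 2) * (sgn t * \<bar>t\<bar> powr (b - 3)))) + D3 t)"
  define w3 where "w3 = (\<lambda>t. - ((b - 1) * ((b - 2) * ((b - 3) * \<bar>t\<bar> powr (b - 4)))) + D4 t)"
  have AE_supp: "AE y in \<rho>. y \<in> supp \<rho>" by (rule AE_in_supp[OF sets_rho])
  then have AE_R: "AE y in \<rho>. \<bar>y\<bar> \<le> R" by eventually_elim (use supp in force)
  have "continuous_on UNIV D1"
    by (intro continuous_at_imp_continuous_on ballI DERIV_isCont[OF D2])
  note W_deriv = singular_kernel_derivative[OF b(1) W D1 this]
  have w: "(W has_real_derivative w t) (at t)" for t using W_deriv(1) by (simp add: w_def)
  have cont_w: "continuous_on UNIV w" using W_deriv(2) by (simp add: w_def)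
  have w1: "(w has_real_derivative w1 t) (at t)" if "t \<noteq> 0" for t
    unfolding w_def w1_def using DERIV_sgn_abs_powr[OF that, of "b - 1"]
    by (intro DERIV_add DERIV_minus D2) (simp add: algebra_simps)
  have w2: "(w1 has_real_derivative w2 t) (at t)" if "t \<noteq> 0" for t
    unfolding w1_def w2_def using DERIV_abs_powr[OF that, of "b - 2"]
    by (intro DERIV_add DERIV_minus D3 DERIV_cmult) simp
  have w3: "(w2 has_real_derivative w3 t) (at t)" if "t \<noteq> 0" for t
    unfolding w2_def w3_def using DERIV_sgn_abs_powr[OF that, of "b - 3"]
    by (intro DERIV_add DERIV_minus D4 DERIV_cmult) simp
  have w3_eq: "w3 t = D4 t - (b - 1) * (2 - b) * (3 - b) * \<bar>t\<bar> powr (b - 4)" for t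
    by (simp add: w3_def algebra_simps)
  have bpos: "0 < (b - 1) * (2 - b) * (3 - b)" using b by simp
  have w3_le: "w3 t \<le> C" if "\<bar>t\<bar> \<le> 2 * R" for t
  proof -
    have "0 \<le> (b - 1) * (2 - b) * (3 - b) * \<bar>t\<bar> powr (b - 4)"
      using less_imp_le[OF bpos] by (rule mult_nonneg_nonneg) simp
    with D4_le[OF that] show ?thesis by (simp add: w3_eq)
  qed
  have w3_le': "w3 t \<le> C - \<kappa>" if "t \<noteq> 0" "\<bar>t\<bar> \<le> 2 * R" "\<bar>t\<bar> \<le> l" for t
  proof -
    have "l powr (b - 4) \<le> \<bar>t\<bar> powr (b - 4)" using that b by (intro powr_mono2') auto
    then have "\<kappa> \<le> (b - 1) * (2 - b) * (3 - b) * \<bar>t\<bar> powr (b - 4)"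
      unfolding \<kappa>_def by (rule mult_left_mono[OF _ less_imp_le[OF bpos]])
    with D4_le[OF that(2)] show ?thesis by (simp add: w3_eq)
  qed
  have \<kappa>: "\<kappa> > 0" unfolding \<kappa>_def using l by (intro mult_pos_pos[OF bpos]) simp
  have C_mass: "C < \<kappa> * measure \<rho> {u..u + l}"
    using C_less mult_left_mono[OF mass, of \<kappa>] \<kappa> by (simp add: \<kappa>_def)

  let ?\<psi> = "conv W \<rho>" and ?g = "conv w \<rho>"
  have g: "(?\<psi> has_real_derivative ?g x) (at x)" for x
    by (rule conv_has_real_derivative[OF sets_rho prob AE_R w cont_w])
  have crit: "?g x = 0" if "x \<in> supp \<rho>" for x
    using DERIV_local_min[OF g[of x] \<epsilon>] loc_min[OF that] by (simp add: abs_minus_commute)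
  have right: "\<exists>t. x < t \<and> t < x + d \<and> 0 \<le> ?g t" if "x \<in> supp \<rho>" "d > 0" for x d
  proof -
    define h where "h = min d \<epsilon> / 2"
    have h: "0 < h" "h < d" "h < \<epsilon>" using that(2) \<epsilon> by (auto simp: h_def)
    obtain t where t: "x < t" "t < x + h" "?\<psi> (x + h) - ?\<psi> x = (x + h - x) * ?g t"
      using MVT2[of x "x + h" ?\<psi> ?g] h g by auto
    have "0 \<le> h * ?g t" using t(3) loc_min[OF that(1), of "x + h"] h by simp
    then show ?thesis using t h by (intro exI[of _ t]) (auto simp: zero_le_mult_iff)
  qed
  have left: "\<exists>t. x - d < t \<and> t < x \<and> ?g t \<le> 0" if "x \<in> supp \<rho>" "d > 0" for x d
  proof -
    define h where "h = min d \<epsilon> / 2"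
    have h: "0 < h" "h < d" "h < \<epsilon>" using that(2) \<epsilon> by (auto simp: h_def)
    obtain t where t: "x - h < t" "t < x" "?\<psi> x - ?\<psi> (x - h) = (x - (x - h)) * ?g t"
      using MVT2[of "x - h" x ?\<psi> ?g] h g by auto
    have "h * ?g t \<le> 0" using t(3) loc_min[OF that(1), of "x - h"] h by simp
    then show ?thesis using t h by (intro exI[of _ t]) (auto simp: mult_le_0_iff)
  qed

  have no_gap: False
    if a: "a \<in> supp \<rho>" "u \<le> a" and c: "c \<in> supp \<rho>" "c \<le> u + l"
      and "a < c" and gap: "supp \<rho> \<inter> {a<..<c} = {}" for a c
  proof -
    \<comment> \<open>The half gap keeps the two interior nodes in the right order.\<close>
    obtain x1 where x1: "a < x1" "x1 < a + (c - a) / 2" "0 \<le> ?g x1"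
      using right[OF a(1), of "(c - a) / 2"] \<open>a < c\<close> by auto
    obtain x2 where x2: "c - (c - a) / 2 < x2" "x2 < c" "?g x2 \<le> 0"
      using left[OF c(1), of "(c - a) / 2"] \<open>a < c\<close> by auto
    have mid: "a + (c - a) / 2 = c - (c - a) / 2" by (simp add: field_simps)
    define A1 A2 A3 where "A1 = x1 - a" and "A2 = x2 - x1" and "A3 = c - x2"
    have pos: "0 < A1" "0 < A2" "0 < A3" using x1 x2 mid by (auto simp: A1_def A2_def A3_def)
    have eqs: "a + A1 = x1" "x1 + A2 = x2" "x2 + A3 = c" by (auto simp: A1_def A2_def A3_def)
    have "a \<in> {-R<..<R}" "c \<in> {-R<..<R}" using supp a c by blast+
    then have "- (A2 * A3 * (A2 + A3)) * ?g a + (A1 + A2) * A3 * (A1 + A2 + A3) * ?g (a + A1)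
      - A1 * (A2 + A3) * (A1 + A2 + A3) * ?g (a + A1 + A2)
      + A1 * A2 * (A1 + A2) * ?g (a + A1 + A2 + A3) < 0"
      using a c AE_supp gap
      by (intro conv_third_difference_neg[OF sets_rho prob pos cont_w w1 w2 w3 AE_R _ _ _ w3_le w3_le' C_mass])
        (auto simp: eqs elim!: eventually_mono)
    then have "(A1 + A2) * A3 * (A1 + A2 + A3) * ?g x1 < A1 * (A2 + A3) * (A1 + A2 + A3) * ?g x2"
      using crit[OF a(1)] crit[OF c(1)] by (simp add: eqs)
    moreover have "0 \<le> (A1 + A2) * A3 * (A1 + A2 + A3) * ?g x1" using pos x1(3) by simp
    moreover have "A1 * (A2 + A3) * (A1 + A2 + A3) * ?g x2 \<le> 0"
      using pos x2(3) by (intro mult_nonneg_nonpos) auto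
    ultimately show False by linarith
  qed

  define S where "S = supp \<rho> \<inter> {u..u + l}"
  have "closed S" unfolding S_def using closed_supp by (intro closed_Int) auto
  have mass_S: "m \<le> measure \<rho> S"
  proof -
    have "measure \<rho> S = measure \<rho> {u..u + l}"
      unfolding S_def using AE_supp closed_supp[of \<rho>]
      by (intro finite_measure_eq_AE) (auto simp: sets_rho elim!: eventually_mono intro!: borel_closed closed_Int)
    with mass show ?thesis by simp
  qed
  then have "S \<noteq> {}" using m by auto
  define p q where "p = Inf S" and "q = Sup S"
  have bdd: "bdd_below S" "bdd_above S" by (auto simp: S_def)
  have p: "p \<in> S" and q: "q \<in> S"
    using closed_contains_Inf[OF \<open>S \<noteq> {}\<close> bdd(1) \<open>closed S\<close>]
      closed_contains_Sup[OF \<open>S \<noteq> {}\<close> bdd(2) \<open>closed S\<close>] by (simp_all add: p_def q_def)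
  have S_pq: "p \<le> x" "x \<le> q" if "x \<in> S" for x
    using that bdd by (auto simp: p_def q_def cInf_lower cSup_upper)
  have sub: "{p..q} \<subseteq> supp \<rho>"
  proof (rule ccontr)
    assume "\<not> {p..q} \<subseteq> supp \<rho>"
    then obtain z where z: "p \<le> z" "z \<le> q" "z \<notin> supp \<rho>" by (meson atLeastAtMost_iff subsetI)
    \<comment> \<open>The gap around the missing point \<open>z\<close>.\<close>
    define a c where "a = Sup (S \<inter> {..z})" and "c = Inf (S \<inter> {z..})"
    have a: "a \<in> S \<inter> {..z}" unfolding a_def
      using p z \<open>closed S\<close> by (intro closed_contains_Sup closed_Int) auto
    have c: "c \<in> S \<inter> {z..}" unfolding c_def
      using q z \<open>closed S\<close> by (intro closed_contains_Inf closed_Int) auto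
    have az: "a < z" "z < c" using a c z(3) by (auto simp: S_def order.order_iff_strict)
    have "supp \<rho> \<inter> {a<..<c} = {}"
    proof (rule ccontr)
      assume "supp \<rho> \<inter> {a<..<c} \<noteq> {}"
      then obtain y where y: "y \<in> supp \<rho>" "a < y" "y < c" by auto
      then have "y \<in> S" using a c by (auto simp: S_def)
      show False
      proof (cases "y \<le> z")
        case True
        then have "y \<le> a" unfolding a_def using \<open>y \<in> S\<close> by (intro cSup_upper) auto
        with y show False by simp
      next
        case False
        then have "c \<le> y" unfolding c_def using \<open>y \<in> S\<close> by (intro cInf_lower) auto
        with y show False by simp
      qed
    qed
    with az a c show False by (intro no_gap[of a c]) (auto simp: S_def)
  qed
  \<comment> \<open>Otherwise some \<open>x\<close> just right of \<open>q\<close>, still within \<open>c0\<close> of \<open>p\<close>, has \<open>\<psi>' x \<ge> 0\<close>; but all the mass in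
    \<open>[p, q]\<close> is so close to \<open>x\<close> and \<open>p\<close> that its repulsion makes \<open>\<psi>' x\<close> less than \<open>\<psi>' p = 0\<close>.\<close>
  have "p + c0 \<le> q"
  proof (rule ccontr)
    assume "\<not> p + c0 \<le> q"
    then have "min (p + c0 - q) (R - q) > 0" using q supp by (auto simp: S_def)
    then obtain x where x: "q < x" "x < p + c0" "x < R" "0 \<le> ?g x"
      using right[of q "min (p + c0 - q) (R - q)"] q by (auto simp: S_def)
    have px: "p < x" using x(1) S_pq(1)[OF q] by linarith
    define s where "s = x - p"
    have s: "0 < s" "s < c0" using px x(2) by (auto simp: s_def)
    have R: "\<bar>x\<bar> \<le> R" "\<bar>p\<bar> \<le> R" using p supp px x(3) by (auto simp: S_def)
    note int = integrable_continuous_diff[OF sets_rho prob AE_R cont_w]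
    have "?g x - ?g p = (LINT y|\<rho>. w (x - y) - w (p - y))"
      unfolding conv_def using int by simp
    also have "\<dots> \<le> (LINT y|\<rho>. C * s - (s / 2) powr (b - 1) * indicator S y)"
    proof (rule integral_mono_AE)
      show "integrable \<rho> (\<lambda>y. w (x - y) - w (p - y))" using int by simp
      show "integrable \<rho> (\<lambda>y. C * s - (s / 2) powr (b - 1) * indicator S y)"
        using \<open>closed S\<close> by (auto simp: sets_rho emeasure_eq_measure borel_closed)
      show "AE y in \<rho>. w (x - y) - w (p - y) \<le> C * s - (s / 2) powr (b - 1) * indicator S y"
        using AE_R
      proof eventually_elim
        case (elim y)
        obtain \<xi> where \<xi>: "p - y < \<xi>" "\<xi> < x - y" "D1 (x - y) - D1 (p - y) = (x - y - (p - y)) * D2 \<xi>"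
          using MVT2[of "p - y" "x - y" D1 D2] px D2 by auto
        have "D2 \<xi> \<le> C" using \<xi> R elim by (intro D2_le) auto
        then have "D1 (x - y) - D1 (p - y) \<le> C * s" using \<xi>(3) s(1) by (simp add: s_def mult.commute)
        moreover have "(s / 2) powr (b - 1) * indicator S y \<le>
            sgn (x - y) * \<bar>x - y\<bar> powr (b - 1) - sgn (p - y) * \<bar>p - y\<bar> powr (b - 1)"
        proof (cases "y \<in> S")
          case False
          then show ?thesis using sgn_abs_powr_mono[of "b - 1" "p - y" "x - y"] b px by simp
        next
          case True
          have y: "p \<le> y" "y < x" using S_pq[OF True] x(1) by auto
          \<comment> \<open>One of \<open>x - y\<close> and \<open>y - p\<close> is at least \<open>s / 2\<close>, as they add up to \<open>s\<close>.\<close>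
          have "(s / 2) powr (b - 1) \<le> (x - y) powr (b - 1) + (y - p) powr (b - 1)"
          proof (cases "s / 2 \<le> x - y")
            case True
            then have "(s / 2) powr (b - 1) \<le> (x - y) powr (b - 1)"
              using s b by (intro powr_mono2) auto
            then show ?thesis by (simp add: add_increasing2)
          next
            case False
            then have "s / 2 \<le> y - p" by (simp add: s_def field_simps)
            then have "(s / 2) powr (b - 1) \<le> (y - p) powr (b - 1)"
              using s b by (intro powr_mono2) auto
            then show ?thesis by (simp add: add_increasing)
          qed
          then show ?thesis using True y by (auto simp: sgn_if)
        qed
        ultimately show ?case by (simp add: w_def)
      qed
    qed
    also have "\<dots> = C * s - (s / 2) powr (b - 1) * measure \<rho> S"
      using sets_eq_imp_space_eq[OF sets_rho] prob_space \<open>closed S\<close>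
      by (simp add: sets_rho emeasure_eq_measure borel_closed)
    also have "\<dots> \<le> C * s - (s / 2) powr (b - 1) * m"
      using mult_left_mono[OF mass_S, of "(s / 2) powr (b - 1)"] by simp
    also have "\<dots> < 0" using c0(2)[OF s] by (simp add: mult.commute)
    finally show False using x(4) crit[of p] p by (simp add: S_def)
  qed
  with sub show ?thesis by blast
qed

section \<open>Hausdorff dimension of sets of positive Lebesgue measure\<close>

text \<open>Any covering set of diameter \<open>d \<le> 1\<close> lies in an interval of length \<open>2 d\<close>, and \<open>d \<le> d\<^sup>s\<close>.\<close>

lemma lebesgue_le_2_hausdorff_measure:
  fixes A :: "real set"
  assumes "s \<le> 1" and s: "0 \<le> s" and A: "A \<in> sets borel"
  shows "emeasure lborel A \<le> 2 * hausdorff_measure s A"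
proof -
  have "emeasure lborel A \<le> 2 * (\<Sum>i. hausdorff_gauge s (U i))"
    if U: "A \<subseteq> (\<Union>i. U i)" "\<And>i. bounded (U i) \<and> diameter (U i) \<le> 1" for U :: "nat \<Rightarrow> real set"
  proof -
    have "\<exists>F \<in> sets borel. U i \<subseteq> F \<and> emeasure lborel F \<le> 2 * hausdorff_gauge s (U i)" for i
    proof (cases "U i = {}")
      case False
      then obtain x where x: "x \<in> U i" by blast
      define d where "d = diameter (U i)"
      have d: "0 \<le> d" "d \<le> 1" using U(2) by (auto simp: d_def diameter_ge_0)
      have "d \<le> d powr s" if "s \<noteq> 0"
        using powr_mono'[of s 1 d] assms(1) d by simp
      then have "ennreal d \<le> hausdorff_gauge s (U i)"
        using False d by (auto simp: hausdorff_gauge_def d_def ennreal_leI)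
      then have "2 * ennreal d \<le> 2 * hausdorff_gauge s (U i)" by (rule mult_left_mono) simp
      moreover have "emeasure lborel {x - d..x + d} = 2 * ennreal d"
        using d ennreal_mult[of 2 d] by simp
      moreover have "U i \<subseteq> {x - d..x + d}"
        using diameter_bounded_bound[of "U i" x] U(2) x by (force simp: d_def dist_real_def)
      ultimately show ?thesis by (intro bexI[of _ "{x - d..x + d}"]) auto
    qed (auto simp: hausdorff_gauge_def)
    then obtain F where F: "\<And>i. F i \<in> sets borel" "\<And>i. U i \<subseteq> F i"
      "\<And>i. emeasure lborel (F i) \<le> 2 * hausdorff_gauge s (U i)" by metis
    have "emeasure lborel A \<le> emeasure lborel (\<Union>i. F i)"
      using U(1) F(1,2) by (intro emeasure_mono) (auto, blast)
    also have "\<dots> \<le> (\<Sum>i. emeasure lborel (F i))"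
      using F(1) by (intro emeasure_subadditive_countably) auto
    also have "\<dots> \<le> (\<Sum>i. 2 * hausdorff_gauge s (U i))"
      using F(3) by (intro suminf_le) auto
    finally show ?thesis by simp
  qed
  then have "emeasure lborel A / 2 \<le> hausdorff_premeasure s 1 A"
    unfolding hausdorff_premeasure_def
    by (intro INF_greatest divide_le_posI_ennreal) auto
  also have "\<dots> \<le> hausdorff_measure s A"
    unfolding hausdorff_measure_def by (intro SUP_upper) auto
  finally have "2 * (emeasure lborel A / 2) \<le> 2 * hausdorff_measure s A" by (rule mult_left_mono) simp
  also have "2 * (emeasure lborel A / 2) = emeasure lborel A"
    using mult_divide_eq_ennreal[of 2 "emeasure lborel A"]
    by (simp add: ennreal_times_divide mult.commute)
  finally show ?thesis .
qed

text \<open>Covering by \<open>n\<close> intervals of length \<open>L / n\<close> costs \<open>n (L / n)\<^sup>s\<close>, which tends to \<open>0\<close>.\<close>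

lemma hausdorff_measure_bounded_real:
  fixes A :: "real set"
  assumes "1 < s" and A: "A \<subseteq> {u..v}" and "u < v"
  shows "hausdorff_measure s A = 0"
proof -
  have "hausdorff_premeasure s \<delta> A \<le> 0" if "\<delta> > 0" for \<delta>
  proof (rule tendsto_lowerbound)
    define L where "L = v - u"
    have L: "L > 0" using assms by (simp add: L_def)
    have "(\<lambda>n. real (Suc n) * (L / real (Suc n)) powr s) = (\<lambda>n. L powr s * real (Suc n) powr (1 - s))"
      using L by (simp add: fun_eq_iff powr_divide powr_diff)
    moreover have "(\<lambda>n. real (Suc n) powr (1 - s)) \<longlonglongrightarrow> 0"
      using assms by (intro tendsto_neg_powr filterlim_compose[OF filterlim_real_sequentially filterlim_Suc]) simp
    ultimately have "(\<lambda>n. real (Suc n) * (L / real (Suc n)) powr s) \<longlonglongrightarrow> 0"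
      using tendsto_mult_right_zero by fastforce
    then show "(\<lambda>n. ennreal (real (Suc n) * (L / real (Suc n)) powr s)) \<longlonglongrightarrow> 0"
      using tendsto_ennrealI by fastforce
    have "(\<lambda>n. L / real (Suc n)) \<longlonglongrightarrow> 0"
      using LIMSEQ_Suc[OF lim_const_over_n[of L]] by simp
    then have "\<forall>\<^sub>F n in sequentially. L / real (Suc n) < \<delta>" using that by (rule order_tendstoD)
    then show "\<forall>\<^sub>F n in sequentially.
        hausdorff_premeasure s \<delta> A \<le> ennreal (real (Suc n) * (L / real (Suc n)) powr s)"
    proof eventually_elim
      case (elim n)
      define h where "h = L / real (Suc n)"
      have h: "h > 0" using L by (simp add: h_def)
      define U where "U = (\<lambda>i. if i \<le> n then {u + real i * h..u + real (Suc i) * h} else {})"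
      have diam: "diameter (U i) = (if i \<le> n then h else 0)" for i
        using h by (simp add: U_def algebra_simps)
      have "A \<subseteq> (\<Union>i. U i)"
      proof
        fix x assume "x \<in> A"
        then have x: "u \<le> x" "x \<le> v" using A by auto
        define j where "j = nat \<lfloor>(x - u) / h\<rfloor>"
        have fl: "real j \<le> (x - u) / h" "(x - u) / h < real j + 1"
          using x h by (auto simp: j_def floor_less_iff)
        then have j: "u + real j * h \<le> x" "x < u + real (Suc j) * h"
          using h by (auto simp: field_simps)
        show "x \<in> (\<Union>i. U i)"
        proof (cases "j \<le> n")
          case True
          then show ?thesis using j by (auto simp: U_def intro!: exI[of _ j])
        next
          case False
          have "u + real (Suc n) * h = v" by (simp add: h_def L_def)
          moreover have "real (Suc n) * h \<le> real j * h" using False h by (intro mult_right_mono) auto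
          \<comment> \<open>Only the right end point \<open>v\<close> gets an index beyond \<open>n\<close>; it belongs to the last interval.\<close>
          ultimately have "x = u + real (Suc n) * h" using j x by linarith
          then show ?thesis using h by (auto simp: U_def algebra_simps intro!: exI[of _ n])
        qed
      qed
      moreover have "bounded (U i) \<and> diameter (U i) \<le> \<delta>" for i
        using elim that by (simp add: diam, simp add: U_def h_def)
      ultimately have "hausdorff_premeasure s \<delta> A \<le> (\<Sum>i. hausdorff_gauge s (U i))"
        unfolding hausdorff_premeasure_def by (intro INF_lower) auto
      also have "\<dots> = (\<Sum>i\<le>n. hausdorff_gauge s (U i))"
        by (rule suminf_finite) (auto simp: hausdorff_gauge_def U_def)
      also have "\<dots> = (\<Sum>i\<le>n. ennreal (h powr s))"
      proof (rule sum.cong)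
        fix i assume "i \<in> {..n}"
        then show "hausdorff_gauge s (U i) = ennreal (h powr s)"
          using assms(1) h diam[of i] by (auto simp: hausdorff_gauge_def U_def)
      qed simp
      also have "\<dots> = ennreal (real (Suc n) * h powr s)"
        by (simp only: sum_constant card_atMost ennreal_of_nat_eq_real_of_nat)
          (rule ennreal_mult[symmetric], auto)
      finally show ?case by (simp only: h_def)
    qed
  qed simp
  then show ?thesis by (simp add: hausdorff_measure_def SUP_eq_const le_zero_eq bot_ennreal)
qed

lemma hausdorff_dim_eq_1:
  fixes A :: "real set"
  assumes A: "A \<in> sets borel" "A \<subseteq> {u..v}" and pos: "emeasure lborel A > 0"
  shows "hausdorff_dim A = 1"
proof (rule antisym)
  have "u < v"
  proof (rule ccontr)
    assume "\<not> u < v"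
    have "emeasure lborel A \<le> emeasure lborel {u..v}" using A by (intro emeasure_mono) auto
    with \<open>\<not> u < v\<close> pos show False by (cases "u = v") auto
  qed
  have le: "hausdorff_dim A \<le> ennreal s" if "1 < s" for s
    unfolding hausdorff_dim_def
    using hausdorff_measure_bounded_real[OF that A(2) \<open>u < v\<close>] that by (intro INF_lower) auto
  have "hausdorff_dim A \<le> 1 + ennreal e" if "0 < e" for e
    using le[of "1 + e"] that by (simp add: ennreal_plus)
  then show "hausdorff_dim A \<le> 1" by (rule ennreal_le_epsilon)
  show "1 \<le> hausdorff_dim A"
    unfolding hausdorff_dim_def
  proof (rule INF_greatest)
    fix s assume "s \<in> {s. 0 \<le> s \<and> hausdorff_measure s A = 0}"
    then have "\<not> s \<le> 1" using lebesgue_le_2_hausdorff_measure[of s A] A pos by auto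
    then have "1 \<le> s" by simp
    then show "1 \<le> ennreal s" by (metis ennreal_1 ennreal_leI)
  qed
qed

section \<open>Lower bound on the size of the support\<close>

text \<open>It remains to choose the constants. Of the \<open>N\<close> intervals of length \<open>l = 2 R / N\<close> that cover
  \<open>[-R, R]\<close>, one has mass at least \<open>m = 1 / N\<close>. Since \<open>l\<^sup>b\<^sup>-\<^sup>4 m\<close> is a constant times
  \<open>N\<^sup>3\<^sup>-\<^sup>b \<ge> N\<close>, a large \<open>N\<close> makes it exceed any bound.\<close>

theorem theorem6p1:
  fixes b R M :: real
  assumes "1 < b" and "b < 2" and "0 < R"
  shows "\<exists>c>0. \<forall>(W1 :: real \<Rightarrow> real) (W :: real \<Rightarrow> real) (\<rho> :: real measure).
     smooth W1 \<longrightarrow>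
     C_norm 4 {-(2 * R)..2 * R} W1 = M \<longrightarrow>
     (\<forall>x. W x = - (\<bar>x\<bar> powr b / b) + W1 x) \<longrightarrow>
     (\<forall>x. W x = W (- x)) \<longrightarrow>
     bdd_below (range W) \<longrightarrow>
     sets \<rho> = sets borel \<longrightarrow>
     prob_space \<rho> \<longrightarrow>
     d_inf_local_minimizer W \<rho> \<longrightarrow>
     supp \<rho> \<subseteq> {-R<..<R} \<longrightarrow>
     C1_on {-R..R} (conv W \<rho>) \<longrightarrow>
     emeasure lborel (supp \<rho>) \<ge> ennreal c \<and> hausdorff_dim (supp \<rho>) = 1"
proof -
  define C where "C = \<bar>M\<bar> + 1"
  have C: "C > 0" by (simp add: C_def)
  define \<kappa> where "\<kappa> = (b - 1) * (2 - b) * (3 - b)"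
  have \<kappa>: "\<kappa> > 0" using assms by (simp add: \<kappa>_def)
  \<comment> \<open>With this \<open>N\<close>, \<open>\<kappa> * l\<^sup>b\<^sup>-\<^sup>4 * m = \<kappa> * (2 R)\<^sup>b\<^sup>-\<^sup>4 * N\<^sup>3\<^sup>-\<^sup>b\<close> exceeds \<open>C\<close>, because \<open>N\<^sup>3\<^sup>-\<^sup>b \<ge> N\<close>.\<close>
  obtain N :: nat where N: "N > 0" "C * (2 * R) powr (4 - b) / \<kappa> < real N"
    using reals_Archimedean2[of "max 0 (C * (2 * R) powr (4 - b) / \<kappa>)"] by auto
  define l where "l = 2 * R / real N"
  define m where "m = 1 / real N"
  have l: "l > 0" using N(1) assms by (simp add: l_def)
  have m: "m > 0" using N(1) by (simp add: m_def)
  have C_less: "C < \<kappa> * l powr (b - 4) * m"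
  proof -
    have "real N powr 1 \<le> real N powr (3 - b)" using N(1) assms by (intro powr_mono) auto
    also have "\<dots> = real N powr (4 - b) * m"
      using N(1) powr_diff[of "real N" "4 - b" 1] by (simp add: m_def)
    finally have "C * (2 * R) powr (4 - b) / \<kappa> < real N powr (4 - b) * m" using N by simp
    then have "C * (2 * R) powr (4 - b) < \<kappa> * (real N powr (4 - b) * m)"
      using \<kappa> by (simp add: divide_less_eq mult.commute)
    then have "C < \<kappa> * (real N powr (4 - b) * m) / (2 * R) powr (4 - b)"
      using assms by (simp add: less_divide_eq)
    also have "\<dots> = \<kappa> * (real N powr (4 - b) / (2 * R) powr (4 - b)) * m" by simp
    also have "real N powr (4 - b) / (2 * R) powr (4 - b) = l powr (b - 4)"
      using N(1) assms powr_minus[of l "4 - b"] by (simp add: l_def powr_divide)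
    finally show ?thesis .
  qed
  \<comment> \<open>\<open>C * s < m * (s / 2)\<^sup>b\<^sup>-\<^sup>1\<close> means \<open>s\<^sup>2\<^sup>-\<^sup>b < \<theta>\<close>, so \<open>c0\<close> is the threshold for \<open>s\<close>.\<close>
  define \<theta> where "\<theta> = m * (1 / 2) powr (b - 1) / C"
  have \<theta>: "\<theta> > 0" using m C by (simp add: \<theta>_def)
  define c0 where "c0 = \<theta> powr (1 / (2 - b))"
  have c0: "c0 > 0" using \<theta> by (simp add: c0_def)
  have c0_less: "C * s < m * (s / 2) powr (b - 1)" if s: "0 < s" "s < c0" for s
  proof -
    have "s powr (2 - b) < c0 powr (2 - b)" using s assms by (intro powr_less_mono2) auto
    also have "\<dots> = \<theta>" using \<theta> assms by (simp add: c0_def powr_powr)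
    finally have "C * s powr (2 - b) < m * (1 / 2) powr (b - 1)"
      using C by (simp add: \<theta>_def less_divide_eq mult.commute)
    then have "C * s powr (2 - b) * s powr (b - 1) < m * (1 / 2) powr (b - 1) * s powr (b - 1)"
      using s by (intro mult_strict_right_mono) auto
    moreover have "s powr (2 - b) * s powr (b - 1) = s" using s by (simp flip: powr_add)
    moreover have "(1 / 2) powr (b - 1) * s powr (b - 1) = (s / 2) powr (b - 1)"
      using s by (simp flip: powr_mult)
    ultimately show ?thesis by (simp add: mult.assoc)
  qed
  have "emeasure lborel (supp \<rho>) \<ge> ennreal c0 \<and> hausdorff_dim (supp \<rho>) = 1"
    if W1: "smooth W1" and norm: "C_norm 4 {-(2 * R)..2 * R} W1 = M"
      and W: "\<forall>x. W x = - (\<bar>x\<bar> powr b / b) + W1 x" and sym: "\<forall>x. W x = W (- x)"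
      and sets_rho: "sets \<rho> = sets borel" and prob: "prob_space \<rho>"
      and minimizer: "d_inf_local_minimizer W \<rho>" and supp: "supp \<rho> \<subseteq> {-R<..<R}"
    for W1 W :: "real \<Rightarrow> real" and \<rho> :: "real measure"
  proof -
    interpret prob_space \<rho> by fact
    define D where "D = (\<lambda>n. (deriv ^^ n) W1)"
    have D: "(D n has_real_derivative D (Suc n) t) (at t)" for n t
      using W1 by (simp add: smooth_def D_def DERIV_deriv_iff_real_differentiable)
    have cont_D: "continuous_on S (D n)" for S n
      using D DERIV_isCont continuous_at_imp_continuous_on by blast
    have D_le: "D i t \<le> C" if i: "i \<le> 4" and t: "\<bar>t\<bar> \<le> 2 * R" for i t
    proof -
      let ?I = "{-(2 * R)..2 * R}"
      have bdd: "bdd_above ((\<lambda>x. \<bar>D n x\<bar>) ` ?I)" for n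
        using cont_D by (intro bounded_imp_bdd_above compact_imp_bounded compact_continuous_image)
          (auto intro!: continuous_intros)
      have "0 \<in> ?I" using assms by simp
      then have nonneg: "0 \<le> (SUP x\<in>?I. \<bar>D n x\<bar>)" for n
        using cSUP_upper[OF _ bdd, of 0 n] by (meson abs_ge_zero order_trans)
      have "\<bar>D i t\<bar> \<le> (SUP x\<in>?I. \<bar>D i x\<bar>)" using t by (intro cSUP_upper bdd) auto
      also have "\<dots> \<le> (\<Sum>n\<le>4. SUP x\<in>?I. \<bar>D n x\<bar>)"
        using i nonneg by (intro member_le_sum) auto
      also have "\<dots> = M" using norm by (simp add: C_norm_def D_def)
      finally show ?thesis by (simp add: C_def)
    qed
    define w where "w = (\<lambda>t. - (sgn t * \<bar>t\<bar> powr (b - 1)) + D 1 t)"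
    have D1: "(W1 has_real_derivative D 1 t) (at t)" for t using D[of 0] by (simp add: D_def)
    have AE_supp: "AE y in \<rho>. y \<in> supp \<rho>" by (rule AE_in_supp[OF sets_rho])
    have AE_R: "AE y in \<rho>. \<bar>y\<bar> \<le> R"
      using AE_supp by eventually_elim (use supp in force)
    note W_deriv = singular_kernel_derivative[OF assms(1) _ D1 cont_D]
    have dW: "(W has_real_derivative w t) (at t)" for t
      using W_deriv(1)[of W] W by (simp add: w_def)
    have "continuous_on UNIV w" using W_deriv(2) by (simp add: w_def)
    then have "(conv W \<rho> has_real_derivative conv w \<rho> x) (at x)" for x
      using conv_has_real_derivative[OF sets_rho prob AE_R dW] by blast
    then have "isCont (conv W \<rho>) x" for x using DERIV_isCont by blast
    moreover have "continuous_on UNIV W"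
      using dW DERIV_isCont continuous_at_imp_continuous_on by blast
    ultimately obtain \<epsilon> where \<epsilon>: "\<epsilon> > 0"
      "\<And>x z. x \<in> supp \<rho> \<Longrightarrow> \<bar>z - x\<bar> < \<epsilon> \<Longrightarrow> conv W \<rho> x \<le> conv W \<rho> z"
      using d_inf_local_minimizer_imp_local_min[OF sets_rho prob _ _ supp minimizer] sym by metis
    have "\<exists>u. m \<le> measure \<rho> {u..u + l}"
    proof (rule ccontr)
      assume "\<nexists>u. m \<le> measure \<rho> {u..u + l}"
      then have small: "measure \<rho> {u..u + l} < m" for u by (simp add: not_le)
      define I where "I = (\<lambda>i. {- R + real i * l..- R + real i * l + l})"
      have cover: "{-R<..<R} \<subseteq> (\<Union>i<N. I i)"
      proof
        fix x assume x: "x \<in> {-R<..<R}"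
        define i where "i = nat \<lfloor>(x + R) / l\<rfloor>"
        have i: "real i \<le> (x + R) / l" "(x + R) / l < real i + 1"
          using x l by (auto simp: i_def floor_less_iff)
        have "(x + R) / l < real N" using x l N(1) by (simp add: l_def divide_less_eq field_simps)
        with i(1) have "i < N" by simp
        moreover have "x \<in> I i" using i l by (simp add: I_def field_simps)
        ultimately show "x \<in> (\<Union>i<N. I i)" by blast
      qed
      have "AE x in \<rho>. x \<in> (\<Union>i<N. I i)"
        using AE_supp by eventually_elim (use supp cover in blast)
      moreover have "(\<Union>i<N. I i) \<in> sets \<rho>" by (auto simp: sets_rho I_def)
      ultimately have "1 = measure \<rho> (\<Union>i<N. I i)" by (simp add: prob_eq_1)
      also have "\<dots> \<le> (\<Sum>i<N. measure \<rho> (I i))"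
        by (intro finite_measure_subadditive_finite) (auto simp: sets_rho I_def)
      also have "\<dots> < (\<Sum>i<N. m)"
        using N(1) small by (intro sum_strict_mono) (auto simp: I_def)
      also have "\<dots> = 1" using N(1) by (simp add: m_def)
      finally show False by simp
    qed
    then obtain u where u: "m \<le> measure \<rho> {u..u + l}" by blast
    have "\<exists>p q. p + c0 \<le> q \<and> {p..q} \<subseteq> supp \<rho>"
    proof (rule support_contains_interval[OF assms(1,2) sets_rho prob supp _ D1 _ _ _ _ _ \<epsilon> l m u _ c0 c0_less])
      show "C < (b - 1) * (2 - b) * (3 - b) * l powr (b - 4) * m" using C_less by (simp add: \<kappa>_def)
      show "(D 1 has_real_derivative D 2 t) (at t)" "(D 2 has_real_derivative D 3 t) (at t)"
        "(D 3 has_real_derivative D 4 t) (at t)" for t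
        using D[of 1] D[of 2] D[of 3] by (simp_all add: numeral_eq_Suc)
    qed (use W D_le in auto)
    then obtain p q where pq: "p + c0 \<le> q" "{p..q} \<subseteq> supp \<rho>" by blast
    have meas: "supp \<rho> \<in> sets borel" using closed_supp by (rule borel_closed)
    have "ennreal c0 \<le> ennreal (q - p)" using pq(1) by (intro ennreal_leI) simp
    also have "\<dots> = emeasure lborel {p..q}" using pq(1) c0 by simp
    also have "\<dots> \<le> emeasure lborel (supp \<rho>)" using pq(2) meas by (intro emeasure_mono) auto
    finally have le: "ennreal c0 \<le> emeasure lborel (supp \<rho>)" .
    moreover have "hausdorff_dim (supp \<rho>) = 1"
    proof (rule hausdorff_dim_eq_1[OF meas])
      show "supp \<rho> \<subseteq> {-R..R}" using supp by force
      show "0 < emeasure lborel (supp \<rho>)" using le c0 by (metis ennreal_less_zero_iff less_le_trans)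
    qed
    ultimately show ?thesis by blast
  qed
  with c0 show ?thesis by blast
qed

end
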